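(* Let $F$ be a finite field and let $C,D\subseteq F^n$ be linear codes such that the pair $(C,D)$ is Product-MDS, i.e. $d_{\min}(CD)\ge 2$ and $d_{\min}(CD)=n-\dim C-\dim D+2$. Then one of the following situations occurs. (i) $C$ and $D$ are MDS and, if none of them has dimension $1$, they are Reed-Solomon codes with a common evaluation-point sequence. (ii) There is a partition of the coordinate set into non-empty subsets $\{1,\dots,n\}=I_1\cup\dots\cup I_h$ and there exist $h$ pairs $(C_1,D_1),\dots,(C_h,D_h)$ of codes of $F^n$ such that $\operatorname{supp} C_i=\operatorname{supp} D_i=I_i$ for all $i=1,\dots,h$, and such that $C$ and $D$ decompose as $C=C_1\oplus\dots\oplus C_h$ and $D=D_1\oplus\dots\oplus D_h$. Furthermore, for all $i=1,\dots,h$, when $C_i$ and $D_i$ are identified with codes of $F^{|I_i|}$ through the natural projection on their support, we have $C_i=(g_iD_i)^\perp$ for some $g_i\in(F^{|I_i|})^\times$.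
   Context: A (linear) code is an $F$-linear subspace of $F^n$. For $x,y\in F^n$, $xy$ denotes the coordinatewise product; for codes $C,D$, $CD$ is the $F$-span of all $xy$ with $x\in C$, $y\in D$. $d_{\min}$ is the minimum Hamming weight of a non-zero vector. The support of a code is the union of the supports of its vectors. A code $C\subseteq F^n$ is MDS if $\dim C+d_{\min}(C)=n+1$. $(F^m)^\times$ is the set of vectors of $F^m$ with no zero entry; $gD=\{gy:y\in D\}$; $^\perp$ is the dual with respect to the standard inner product. A Reed-Solomon code of length $n$ and dimension $k$ is a code of the form $\{(g_1f(\alpha_1),\dots,g_nf(\alpha_n)): f\in F[X],\ \deg f<k\}$, where $g_1,\dots,g_n\in F$ are non-zero and $\alpha_1,\dots,\alpha_n\in F\cup\{\infty\}$ are pairwise distinct, with the convention that $f(\infty)$ is the coefficient of $X^{k-1}$ in $f$; $(\alpha_1,\dots,\alpha_n)$ is called an evaluation-point sequence for the code.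
   Formalization: Both codes C and D are additionally assumed to have full support {1,…,n}; without this the claim fails, e.g. C=⟨(1,1,0)⟩, D=⟨(1,1,0),(0,0,1)⟩, and each of (i) and (ii) forces full support anyway. *)

theory Defs
  imports
    "HOL-Analysis.Cartesian_Space"
    "HOL-Computational_Algebra.Polynomial"
    "HOL-Library.FuncSet"
    "HOL-Library.Disjoint_Sets"
begin

text \<open>
  A code is a \<open>vec.subspace\<close> of \<open>'a ^ 'n\<close>; its length is \<open>CARD('n)\<close>, and the coordinate set
  \<open>{1, ..., n}\<close> is the index type \<open>'n\<close>.  The operation \<open>*\<close> on \<open>'a ^ 'n\<close> is the coordinatewise product.
\<close>

definition vsupp :: "'a::zero ^ 'n \<Rightarrow> 'n set" where
  "vsupp x = {i. x $ i \<noteq> 0}"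

definition supp :: "('a::zero ^ 'n) set \<Rightarrow> 'n set" where
  "supp C = (\<Union>x\<in>C. vsupp x)"

text \<open>
  The classification of Product-MDS pairs concerns codes of full support, \<open>supp C = UNIV\<close>; both of
  its alternatives force this.  Without it there are further pairs: over any field, let
  \<open>C\<close> be spanned by \<open>(1,1,0)\<close> and \<open>D\<close> by \<open>(1,1,0)\<close> and \<open>(0,0,1)\<close>.  Then \<open>C D = C\<close> has minimum
  distance \<open>2 = 3 - 1 - 2 + 2\<close>, but neither code is MDS and \<open>supp C \<noteq> supp D\<close>.
\<close>

definition hweight :: "'a::zero ^ 'n \<Rightarrow> nat" where
  "hweight x = card (vsupp x)"

text \<open>
  The zero code has no minimum distance; with the value \<open>0\<close> chosen here it is not MDS, and
  no pair with zero product is Product-MDS.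
\<close>

definition d_min :: "('a::zero ^ 'n) set \<Rightarrow> nat" where
  "d_min C = (if C \<subseteq> {0} then 0 else Inf (hweight ` (C - {0})))"

definition code_prod :: "('a::field ^ 'n) set \<Rightarrow> ('a ^ 'n) set \<Rightarrow> ('a ^ 'n) set" where
  "code_prod C D = vec.span {x * y | x y. x \<in> C \<and> y \<in> D}"

definition MDS :: "('a::field ^ 'n) set \<Rightarrow> bool" where
  "MDS C \<longleftrightarrow> vec.dim C + d_min C = CARD('n) + 1"

text \<open>
  The equation \<open>d_min (C D) = n - dim C - dim D + 2\<close> is read over the integers, hence
  written without subtraction.
\<close>

definition product_MDS :: "('a::field ^ 'n) set \<Rightarrow> ('a ^ 'n) set \<Rightarrow> bool" where
  "product_MDS C D \<longleftrightarrow>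
     d_min (code_prod C D) \<ge> 2 \<and>
     d_min (code_prod C D) + vec.dim C + vec.dim D = CARD('n) + 2"

text \<open>Points of \<open>F \<union> {\<infinity>}\<close> are elements of \<open>'a option\<close>, with \<open>None\<close> for \<open>\<infinity>\<close>.\<close>

definition eval_at :: "nat \<Rightarrow> 'a::field poly \<Rightarrow> 'a option \<Rightarrow> 'a" where
  "eval_at k f \<alpha> = (case \<alpha> of Some a \<Rightarrow> poly f a | None \<Rightarrow> coeff f (k - 1))"

definition reed_solomon_at :: "('n \<Rightarrow> 'a::field option) \<Rightarrow> ('a ^ 'n) set \<Rightarrow> bool" where
  "reed_solomon_at \<alpha> C \<longleftrightarrow>
     inj \<alpha> \<and>
     (\<exists>k (g :: 'a ^ 'n). vec.dim C = k \<and> (\<forall>i. g $ i \<noteq> 0) \<and>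
        C = {(\<chi> i. g $ i * eval_at k f (\<alpha> i)) | f. f = 0 \<or> degree f < k})"

text \<open>
  \<open>C\<close> is the internal direct sum of the codes \<open>Cs i\<close>, \<open>i \<in> J\<close>: every element of \<open>C\<close> is
  \<open>\<Sum>i\<in>J. x i\<close> for exactly one family of \<open>x i \<in> Cs i\<close>, and all such sums lie in \<open>C\<close>.
\<close>

definition direct_sum :: "'i set \<Rightarrow> ('i \<Rightarrow> ('a::field ^ 'n) set) \<Rightarrow> ('a ^ 'n) set \<Rightarrow> bool" where
  "direct_sum J Cs C \<longleftrightarrow> bij_betw (\<lambda>x. \<Sum>i\<in>J. x i) (\<Pi>\<^sub>E i\<in>J. Cs i) C"

text \<open>
  The space \<open>F^|I|\<close>, with coordinates labelled by the elements of \<open>I\<close>, is \<open>I \<rightarrow>\<^sub>E UNIV\<close>.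
  \<open>proj_on I\<close> is the natural projection of \<open>F^n\<close> onto it.
\<close>

definition proj_on :: "'n set \<Rightarrow> 'a ^ 'n \<Rightarrow> 'n \<Rightarrow> 'a" where
  "proj_on I x = (\<lambda>i\<in>I. x $ i)"

definition scale_on :: "'n set \<Rightarrow> ('n \<Rightarrow> 'a::times) \<Rightarrow> ('n \<Rightarrow> 'a) set \<Rightarrow> ('n \<Rightarrow> 'a) set" where
  "scale_on I g D = (\<lambda>y. \<lambda>i\<in>I. g i * y i) ` D"

definition dual_on :: "'n set \<Rightarrow> ('n \<Rightarrow> 'a::comm_ring) set \<Rightarrow> ('n \<Rightarrow> 'a) set" where
  "dual_on I D = {x \<in> I \<rightarrow>\<^sub>E UNIV. \<forall>y\<in>D. (\<Sum>i\<in>I. x i * y i) = 0}"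

end

theory Submission
  imports Defs
begin

text \<open>
  Write \<open>k = dim C\<close>, \<open>l = dim D\<close>, \<open>d = d_min (C D)\<close> and let \<open>E\<close> be the dual of \<open>C D\<close>.

  If \<open>d = 2\<close>, an information set \<open>A\<close> of \<open>C\<close> is the complement of an information set of \<open>D\<close>: a vector
  of \<open>D\<close> supported in \<open>A\<close> would have a product of weight one with a vector of the systematic basis of
  \<open>C\<close>.  Products of vectors of the two systematic bases have weight at most two, so they force
  coordinates linked by a non-zero entry of a basis vector to vanish simultaneously on \<open>E\<close>.  The
  classes of coordinates that vanish simultaneously on \<open>E\<close> are the blocks of the decomposition, and
  a vector of \<open>E\<close> that is non-zero on a block gives the multiplier \<open>g\<close> there.

  If \<open>d \<ge> 3\<close>, a word of \<open>C\<close> that is too light for an MDS code yields non-zero subcodes of \<open>C\<close> and \<open>D\<close>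
  with disjoint supports, each the full subcode vanishing on the support of the other; adding up the
  product Singleton bounds on these two supports gives \<open>d \<le> 2\<close>.  So \<open>C\<close> and \<open>D\<close> are MDS, and
  then \<open>E\<close> is too.  For the Reed-Solomon structure, induct on the dimension of \<open>E\<close>.  If \<open>E\<close> is spanned
  by two vectors \<open>a\<close> and \<open>b\<close>, then \<open>a C + b C\<close> has dimension at most \<open>k + 1\<close>; by counting dimensions,
  the vectors \<open>y\<close> with \<open>a y\<close> and \<open>b y\<close> in \<open>C\<close> form a space of dimension at least \<open>k - 1\<close>, and iterating
  this produces \<open>h\<close> with all \<open>h a\<^sup>j b\<^sup>i\<close>, \<open>i + j = k - 1\<close>, in \<open>C\<close>.  Otherwise shorten \<open>E\<close> and
  puncture \<open>C\<close> and \<open>D\<close> at one coordinate \<open>s\<close>.  In terms of the monomial bases of the punctured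
  codes, the relation \<open>E C D \<bottom> 1\<close> says that the coordinates at \<open>s\<close> form a Hankel matrix of rank one,
  that is, they are evaluations at a common point.
\<close>

section \<open>Linear algebra of codes and information sets\<close>

lemma linear_times: "Vector_Spaces.linear (*s) (*s) ((*) (m :: 'a::field ^ 'n))"
  by unfold_locales (vector algebra_simps)+

lemma subspace_times: "vec.subspace S \<Longrightarrow> vec.subspace ((*) (m :: 'a::field ^ 'n) ` S)"
  by (rule vec.linear_subspace_image[OF linear_times])

lemma dim_le_hyperplane_section:
  fixes S :: "('a::field ^ 'n) set" and f :: "'a ^ 'n \<Rightarrow> 'a"
  assumes S: "vec.subspace S" and f: "Vector_Spaces.linear (*s) (*) f"
  shows "vec.dim S \<le> vec.dim {x \<in> S. f x = 0} + 1"
proof (cases "\<forall>x\<in>S. f x = 0")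
  case True
  then have "{x \<in> S. f x = 0} = S" by auto
  then show ?thesis by simp
next
  case False
  interpret f: Vector_Spaces.linear "(*s)" "(*)" f by (fact f)
  from False obtain u where u: "u \<in> S" "f u \<noteq> 0" by auto
  have "x \<in> vec.span (insert u {x \<in> S. f x = 0})" if "x \<in> S" for x
  proof -
    have "x - (f x / f u) *s u \<in> {x \<in> S. f x = 0}"
      using that u S by (auto simp: f.diff f.scale vec.subspace_diff vec.subspace_scale)
    then show ?thesis
      unfolding vec.span_breakdown_eq by (intro exI vec.span_base)
  qed
  then have "vec.dim S \<le> vec.dim (insert u {x \<in> S. f x = 0})"
    by (intro vec.dim_mono) auto
  also have "\<dots> \<le> vec.dim {x \<in> S. f x = 0} + 1"
    by (simp add: vec.dim_insert)
  finally show ?thesis .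
qed

lemma subspace_linear_eqs:
  fixes f :: "'i \<Rightarrow> 'a::field ^ 'n \<Rightarrow> 'a"
  assumes "vec.subspace S" and "\<And>i. i \<in> T \<Longrightarrow> Vector_Spaces.linear (*s) (*) (f i)"
  shows "vec.subspace {x \<in> S. \<forall>i\<in>T. f i x = 0}"
proof -
  have "f i 0 = 0" "f i (x + y) = f i x + f i y" "f i (c *s x) = c * f i x" if "i \<in> T" for i x y c
  proof -
    interpret Vector_Spaces.linear "(*s)" "(*)" "f i" using assms(2) that .
    show "f i 0 = 0" "f i (x + y) = f i x + f i y" "f i (c *s x) = c * f i x"
      by (simp_all add: zero add scale)
  qed
  with assms(1) show ?thesis
    by (auto simp: vec.subspace_def)
qed

lemma dim_le_linear_eqs:
  fixes f :: "'i \<Rightarrow> 'a::field ^ 'n \<Rightarrow> 'a"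
  assumes "vec.subspace S" and "finite T" and "\<And>i. i \<in> T \<Longrightarrow> Vector_Spaces.linear (*s) (*) (f i)"
  shows "vec.dim S \<le> vec.dim {x \<in> S. \<forall>i\<in>T. f i x = 0} + card T"
  using assms(2,3)
proof (induction T)
  case (insert t T)
  let ?K = "{x \<in> S. \<forall>i\<in>T. f i x = 0}"
  have "vec.dim ?K \<le> vec.dim {x \<in> ?K. f t x = 0} + 1"
    using insert.prems assms(1) by (intro dim_le_hyperplane_section subspace_linear_eqs) auto
  moreover have "{x \<in> ?K. f t x = 0} = {x \<in> S. \<forall>i\<in>insert t T. f i x = 0}" by auto
  ultimately show ?case using insert by auto
qed auto

lemma linear_component: "Vector_Spaces.linear (*s) (*) (\<lambda>x :: 'a::field ^ 'n. x $ i)"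
  by unfold_locales (auto simp: algebra_simps)

lemma linear_dot: "Vector_Spaces.linear (*s) (*) (\<lambda>x :: 'a::field ^ 'n. \<Sum>i\<in>UNIV. v $ i * x $ i)"
  by unfold_locales (auto simp: algebra_simps sum.distrib sum_distrib_left)

lemma subspace_vanishing: "vec.subspace S \<Longrightarrow> vec.subspace {x \<in> S. \<forall>i\<in>T. (x :: 'a::field ^ 'n) $ i = 0}"
  by (rule subspace_linear_eqs) (simp_all add: linear_component)

lemma dim_le_vanishing:
  "vec.subspace S \<Longrightarrow> vec.dim S \<le> vec.dim {x \<in> S. \<forall>i\<in>T. (x :: 'a::field ^ 'n) $ i = 0} + card T"
  by (rule dim_le_linear_eqs) (simp_all add: linear_component)

lemma obtain_nonzero:
  assumes "vec.dim (S :: ('a::field ^ 'n) set) > 0"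
  obtains x where "x \<in> S" "x \<noteq> 0"
proof -
  have "\<not> S \<subseteq> {0}" using assms by (metis vec.dim_eq_0 less_irrefl)
  then show thesis using that by auto
qed

lemma obtain_vanishing:
  assumes "vec.subspace S" and "card T < vec.dim S"
  obtains x :: "'a::field ^ 'n" where "x \<in> S" "x \<noteq> 0" "\<forall>i\<in>T. x $ i = 0"
proof -
  have "0 < vec.dim {x \<in> S. \<forall>i\<in>T. x $ i = 0}"
    using dim_le_vanishing[OF assms(1), of T] assms(2) by linarith
  then show thesis using that by (elim obtain_nonzero) auto
qed

text \<open>The half of rank-nullity that the dimension counts use, for \<open>f\<close> restricted
  to a subspace: preimages of a basis of the image, together with a basis of the kernel, span
  \<open>S\<close>.\<close>

lemma dim_le_image_kernel:
  fixes S :: "('a::field ^ 'n) set" and f :: "'a ^ 'n \<Rightarrow> 'a ^ 'n"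
  assumes S: "vec.subspace S" and f: "Vector_Spaces.linear (*s) (*s) f"
  shows "vec.dim S \<le> vec.dim (f ` S) + vec.dim {x \<in> S. f x = 0}"
proof -
  interpret f: Vector_Spaces.linear "(*s)" "(*s)" f by (fact f)
  obtain B where B: "B \<subseteq> f ` S" "vec.independent B" "f ` S \<subseteq> vec.span B" "card B = vec.dim (f ` S)"
    using vec.basis_exists by blast
  obtain A where A: "A \<subseteq> S" "B = f ` A" "inj_on f A" using B(1)
    by (auto simp: subset_image_inj)
  obtain K where K: "K \<subseteq> {x \<in> S. f x = 0}" "vec.independent K" "{x \<in> S. f x = 0} \<subseteq> vec.span K"
    "card K = vec.dim {x \<in> S. f x = 0}"
    using vec.basis_exists by blast
  have "finite B" "finite K" using B K vec.finiteI_independent by auto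
  then have fin: "finite (A \<union> K)" using A finite_imageD by auto
  have "S \<subseteq> vec.span (A \<union> K)"
  proof
    fix x assume x: "x \<in> S"
    then have "f x \<in> f ` vec.span A"
      using B(3) A(2) f.span_image by auto
    then obtain y where y: "y \<in> vec.span A" "f x = f y" by auto
    have "y \<in> S" using y(1) A(1) S vec.span_minimal by blast
    then have "x - y \<in> vec.span K" using x y S K(3)
      by (auto simp: f.diff vec.subspace_diff)
    then have "y + (x - y) \<in> vec.span (A \<union> K)"
      using y(1) vec.span_mono[of A "A \<union> K"] vec.span_mono[of K "A \<union> K"] by (intro vec.span_add) auto
    then show "x \<in> vec.span (A \<union> K)" by simp
  qed
  then have "vec.dim S \<le> card (A \<union> K)" using fin by (rule vec.dim_le_card)
  also have "\<dots> \<le> card A + card K" by (rule card_Un_le)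
  also have "card A = card B" using A by (simp add: card_image)
  finally show ?thesis using B K by simp
qed

lemma dim_image_inj:
  fixes S :: "('a::field ^ 'n) set" and f :: "'a ^ 'n \<Rightarrow> 'a ^ 'n"
  assumes S: "vec.subspace S" and f: "Vector_Spaces.linear (*s) (*s) f"
    and "\<And>x. x \<in> S \<Longrightarrow> f x = 0 \<Longrightarrow> x = 0"
  shows "vec.dim (f ` S) = vec.dim S"
proof (rule antisym)
  have "{x \<in> S. f x = 0} \<subseteq> {0}" using assms(3) by auto
  then have "vec.dim {x \<in> S. f x = 0} = 0" by (simp only: vec.dim_eq_0)
  then show "vec.dim S \<le> vec.dim (f ` S)" using dim_le_image_kernel[OF S f] by linarith
qed (rule vec.dim_image_le[OF f])

text \<open>On the coordinates in \<open>A\<close> the vectors \<open>c a\<close> form the standard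
  basis: they are the rows of a generator matrix in systematic form, indexed by their
  pivots.\<close>

definition dual_family :: "'n set \<Rightarrow> ('n \<Rightarrow> 'a::field ^ 'n) \<Rightarrow> bool" where
  "dual_family A c \<longleftrightarrow> (\<forall>a\<in>A. \<forall>b\<in>A. c a $ b = (if b = a then 1 else 0))"

lemma dual_family_comb:
  fixes c :: "'n::finite \<Rightarrow> 'a::field ^ 'n"
  assumes "dual_family A c" and "b \<in> A"
  shows "(\<Sum>a\<in>A. x a *s c a) $ b = x b"
proof -
  have "(\<Sum>a\<in>A. x a *s c a) $ b = (\<Sum>a\<in>A. if a = b then x b else 0)"
    unfolding sum_component vector_smult_component
    using assms by (intro sum.cong refl) (auto simp: dual_family_def)
  then show ?thesis using assms(2) by simp
qed

lemma dual_family_card_le_dim: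
  fixes c :: "'n::finite \<Rightarrow> 'a::field ^ 'n"
  assumes "dual_family A c" and "c ` A \<subseteq> S"
  shows "card A \<le> vec.dim S"
proof -
  have inj: "inj_on c A"
    using assms(1) by (auto simp: dual_family_def inj_on_def) (metis zero_neq_one)
  have "vec.independent (c ` A)"
  proof (rule vec.independent_if_scalars_zero)
    fix u x assume u: "(\<Sum>x\<in>c ` A. u x *s x) = 0" and "x \<in> c ` A"
    then obtain a where a: "a \<in> A" "x = c a" by auto
    have "(\<Sum>a\<in>A. u (c a) *s c a) = 0" using u by (simp add: sum.reindex[OF inj])
    then show "u x = 0" using dual_family_comb[OF assms(1) a(1), of "\<lambda>a. u (c a)"] a by simp
  qed simp
  then have "card (c ` A) \<le> vec.dim S" using assms(2) by (intro vec.independent_card_le_dim)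
  then show ?thesis by (simp add: card_image inj)
qed

text \<open>One step of Gauss-Jordan elimination: \<open>x\<close> is normalised at the new pivot
  \<open>i\<close>, and coordinate \<open>i\<close> is cleared from the other vectors. Since
  \<open>x\<close> vanishes on \<open>A\<close>, the old pivots are undisturbed.\<close>

lemma dual_family_extend:
  fixes c :: "'n::finite \<Rightarrow> 'a::field ^ 'n"
  assumes "vec.subspace S" and "dual_family A c" and "c ` A \<subseteq> S"
    and "x \<in> S" and "\<forall>a\<in>A. x $ a = 0" and "x $ i \<noteq> 0"
  obtains c' where "dual_family (insert i A) c'" "c' ` insert i A \<subseteq> S"
proof
  define u where "u = (1 / x $ i) *s x"
  let ?c' = "\<lambda>a. if a = i then u else c a - c a $ i *s u"
  have "i \<notin> A" using assms by auto
  then show "dual_family (insert i A) ?c'"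
    using assms by (auto simp: dual_family_def u_def)
  have "u \<in> S" using assms by (simp add: u_def vec.subspace_scale)
  then show "?c' ` insert i A \<subseteq> S"
    using assms by (auto intro!: vec.subspace_diff vec.subspace_scale)
qed

text \<open>A maximal set of pivots inside \<open>B\<close> works: a non-zero vector vanishing on it
  would, by injectivity on \<open>B\<close>, yield a further pivot, so a vector minus its
  interpolation on \<open>A\<close> is zero. Prescribing \<open>B\<close> controls where the
  information set lies.\<close>

lemma information_set:
  fixes S :: "('a::field ^ 'n::finite) set"
  assumes S: "vec.subspace S" and B: "\<And>x. x \<in> S \<Longrightarrow> \<forall>i\<in>B. x $ i = 0 \<Longrightarrow> x = 0"
  obtains A c where "A \<subseteq> B" "dual_family A c" "c ` A \<subseteq> S" "card A = vec.dim S"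
    "\<forall>x\<in>S. x = (\<Sum>a\<in>A. x $ a *s c a)"
proof -
  define M where "M = {A. A \<subseteq> B \<and> (\<exists>c. dual_family A c \<and> c ` A \<subseteq> S)}"
  have "finite M" "{} \<in> M" by (auto simp: M_def dual_family_def)
  then obtain A where A: "A \<in> M" "\<And>A'. A' \<in> M \<Longrightarrow> A \<subseteq> A' \<Longrightarrow> A = A'"
    using finite_has_maximal[of M] by blast
  then obtain c where c: "A \<subseteq> B" "dual_family A c" "c ` A \<subseteq> S" by (auto simp: M_def)
  have zero: "x = 0" if x: "x \<in> S" "\<forall>a\<in>A. x $ a = 0" for x
  proof (rule ccontr)
    assume "x \<noteq> 0"
    then obtain i where i: "i \<in> B" "x $ i \<noteq> 0" using B x by blast
    then obtain c' where "dual_family (insert i A) c'" "c' ` insert i A \<subseteq> S"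
      using dual_family_extend[OF S c(2,3) x] by blast
    then have "insert i A \<in> M" using c(1) i by (auto simp: M_def)
    then have "i \<in> A" using A(2) by auto
    then show False using x i by auto
  qed
  have comb: "x = (\<Sum>a\<in>A. x $ a *s c a)" if x: "x \<in> S" for x
  proof -
    have "x - (\<Sum>a\<in>A. x $ a *s c a) = 0"
      using x c(3) by (intro zero vec.subspace_diff vec.subspace_sum vec.subspace_scale S)
        (auto simp del: sum_component simp: dual_family_comb[OF c(2)])
    then show ?thesis by simp
  qed
  have "S \<subseteq> vec.span (c ` A)"
    using comb by (metis (no_types, lifting) imageI subsetI vec.span_base vec.span_scale vec.span_sum)
  then have "vec.dim S \<le> card (c ` A)" by (rule vec.dim_le_card) simp
  also have "\<dots> \<le> card A" by (simp add: card_image_le)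
  finally have "card A = vec.dim S" using dual_family_card_le_dim[OF c(2,3)] by simp
  then show thesis using that c comb by blast
qed

lemma dim_le_card_support:
  fixes S :: "('a::field ^ 'n::finite) set"
  assumes "vec.subspace S" and "\<And>x. x \<in> S \<Longrightarrow> \<forall>i\<in>B. x $ i = 0 \<Longrightarrow> x = 0"
  shows "vec.dim S \<le> card B"
proof -
  obtain A c where "A \<subseteq> B" "card A = vec.dim S"
    using information_set[of S B] assms by metis
  then show ?thesis by (metis card_mono finite)
qed

section \<open>Pairs of complementary dimension\<close>

text \<open>Multiplication by \<open>ind J\<close> zeroes the coordinates outside \<open>J\<close>;
  restricting and puncturing are thus done without leaving the type \<open>'a ^ 'n\<close>.\<close>

definition ind :: "'n set \<Rightarrow> 'a::field ^ 'n" where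
  "ind J = (\<chi> i. if i \<in> J then 1 else 0)"

lemma ind_nth [simp]: "ind J $ i = (if i \<in> J then 1 else 0)"
  by (simp add: ind_def)

lemma ind_times_eq: "vsupp x \<subseteq> J \<Longrightarrow> ind J * x = x"
  by (auto simp: vec_eq_iff vsupp_def)

lemma vsupp_ind_times: "vsupp (ind J * x) = vsupp x \<inter> J"
  by (auto simp: vsupp_def)

text \<open>A parity check through \<open>i\<close>: the hypothesis makes \<open>X\<close> inject
  into the other coordinates, so with an information set \<open>A\<close> avoiding \<open>i\<close>
  the entry \<open>x $ i\<close> is a fixed linear combination of the \<open>x $ a\<close>. The
  vector \<open>z\<close> records this relation.\<close>

lemma exists_dual_vector:
  fixes X :: "('a::field ^ 'n::finite) set"
  assumes "vec.subspace X" and "\<And>x. x \<in> X \<Longrightarrow> vsupp x \<subseteq> {i} \<Longrightarrow> x = 0"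
  obtains z where "z $ i \<noteq> 0" "\<forall>x\<in>X. (\<Sum>j\<in>UNIV. z $ j * x $ j) = 0"
proof -
  have inj: "x = 0" if "x \<in> X" "\<forall>j\<in>-{i}. x $ j = 0" for x
    using assms(2)[OF that(1)] that(2) by (auto simp: vsupp_def)
  obtain A c where A: "A \<subseteq> - {i}" "dual_family A c" "c ` A \<subseteq> X" "card A = vec.dim X"
    "\<forall>x\<in>X. x = (\<Sum>a\<in>A. x $ a *s c a)"
    by (rule information_set[OF assms(1) inj])
  define z where "z = (\<chi> j. if j = i then 1 else if j \<in> A then - c j $ i else 0)"
  have "(\<Sum>j\<in>UNIV. z $ j * x $ j) = 0" if x: "x \<in> X" for x
  proof -
    have "(\<Sum>j\<in>UNIV. z $ j * x $ j) = x $ i + (\<Sum>j\<in>UNIV - {i}. z $ j * x $ j)"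
      by (simp add: sum.remove[of UNIV i] z_def)
    also have "(\<Sum>j\<in>UNIV - {i}. z $ j * x $ j) = (\<Sum>a\<in>A. - (x $ a * c a $ i))"
      using A(1) by (intro sum.mono_neutral_cong_right) (auto simp: z_def)
    also have "x $ i = (\<Sum>a\<in>A. x $ a * c a $ i)"
      by (subst bspec[OF A(5) x]) (simp only: sum_component vector_smult_component)
    finally show ?thesis by (simp add: sum_negf)
  qed
  then show thesis using that[of z] by (simp add: z_def)
qed

text \<open>The inverse of summation is masking by the sets \<open>I i\<close>, since by
  disjointness each coordinate of a sum comes from a single summand.\<close>

lemma direct_sum_masks:
  fixes C :: "('a::field ^ 'n::finite) set"
  assumes C: "vec.subspace C" and J: "finite J" and I: "disjoint_family_on I J" "(\<Union>i\<in>J. I i) = UNIV"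
    and mask: "\<And>i x. i \<in> J \<Longrightarrow> x \<in> C \<Longrightarrow> ind (I i) * x \<in> C"
  shows "direct_sum J (\<lambda>i. {x \<in> C. vsupp x \<subseteq> I i}) C"
proof -
  have comp: "(\<Sum>i\<in>J. x i) $ j = x k $ j"
    if "\<forall>i\<in>J. vsupp (x i) \<subseteq> I i" "k \<in> J" "j \<in> I k" for x :: "'b \<Rightarrow> 'a ^ 'n" and j k
  proof -
    have "x i $ j = 0" if "i \<in> J" "i \<noteq> k" for i
    proof -
      have "j \<notin> I i" using I(1) that \<open>k \<in> J\<close> \<open>j \<in> I k\<close> by (auto simp: disjoint_family_on_def)
      then show ?thesis using \<open>\<forall>i\<in>J. vsupp (x i) \<subseteq> I i\<close> that(1) by (auto simp: vsupp_def)
    qed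
    then show ?thesis
      using that(2) J by (simp add: sum.remove)
  qed
  let ?P = "\<Pi>\<^sub>E i\<in>J. {x \<in> C. vsupp x \<subseteq> I i}"
  show ?thesis
    unfolding direct_sum_def
  proof (rule bij_betwI[where g = "\<lambda>y. \<lambda>i\<in>J. ind (I i) * y"])
    show "(\<lambda>x. \<Sum>i\<in>J. x i) \<in> ?P \<rightarrow> C"
      using C by (auto intro!: vec.subspace_sum)
    show "(\<lambda>y. \<lambda>i\<in>J. ind (I i) * y) \<in> C \<rightarrow> ?P"
      using mask by (auto simp: vsupp_ind_times)
  next
    fix x assume x: "x \<in> ?P"
    then have x': "\<forall>i\<in>J. vsupp (x i) \<subseteq> I i" by auto
    show "(\<lambda>i\<in>J. ind (I i) * (\<Sum>i\<in>J. x i)) = x"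
    proof
      fix k
      have "ind (I k) * (\<Sum>i\<in>J. x i) = x k" if "k \<in> J"
        using x' that comp[OF x' that] by (auto simp: vec_eq_iff vsupp_def simp del: sum_component)
      then show "(\<lambda>i\<in>J. ind (I i) * (\<Sum>i\<in>J. x i)) k = x k"
        using PiE_arb[OF x] by (cases "k \<in> J") simp_all
    qed
  next
    fix y assume "y \<in> C"
    have "(\<Sum>i\<in>J. ind (I i) * y) $ j = y $ j" for j
    proof -
      obtain k where k: "k \<in> J" "j \<in> I k" using I(2) by blast
      have "(\<Sum>i\<in>J. ind (I i) * y) $ j = (ind (I k) * y) $ j"
        using k by (intro comp) (auto simp: vsupp_ind_times)
      then show ?thesis using k by simp
    qed
    then show "(\<Sum>i\<in>J. (\<lambda>i\<in>J. ind (I i) * y) i) = y"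
      by (simp add: vec_eq_iff del: sum_component)
  qed
qed

section \<open>Block decomposition of a pair of complementary dimensions\<close>

lemma times_mem_code_prod: "x \<in> C \<Longrightarrow> y \<in> D \<Longrightarrow> x * y \<in> code_prod C D"
  by (auto simp: code_prod_def intro!: vec.span_base)

lemma subspace_code_prod: "vec.subspace (code_prod C D)"
  by (simp add: code_prod_def)

lemma hweight_le_card: "vsupp x \<subseteq> T \<Longrightarrow> hweight x \<le> card (T :: 'n::finite set)"
  unfolding hweight_def by (intro card_mono) auto

lemma mem_supp_iff: "i \<in> supp C \<longleftrightarrow> (\<exists>x\<in>C. x $ i \<noteq> 0)"
  by (auto simp: supp_def vsupp_def)

text \<open>An equivalence class of coordinates. A vector of \<open>E\<close> that is non-zero at
  \<open>i\<close> is non-zero on the whole block, which makes it usable as a multiplier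
  there.\<close>

definition block :: "('a::zero ^ 'n) set \<Rightarrow> 'n \<Rightarrow> 'n set" where
  "block E i = {j. \<forall>z\<in>E. z $ i = 0 \<longleftrightarrow> z $ j = 0}"

lemma block_eqI: "j \<in> block E i \<Longrightarrow> block E j = block E i"
  by (auto simp: block_def)

lemma self_in_block [simp]: "i \<in> block E i"
  by (simp add: block_def)

text \<open>The case \<open>d = 2\<close>. The absence of words of weight one in the product makes
  the information sets complementary and gives every coordinate a dual vector that is non-zero
  there.\<close>

lemma complementary_pair_decomposition:
  fixes C D :: "('a::field ^ 'n::finite) set"
  assumes C: "vec.subspace C" and D: "vec.subspace D"
    and full: "supp C = UNIV" "supp D = UNIV"
    and dim: "vec.dim C + vec.dim D = CARD('n)"
    and wt: "\<And>w. w \<in> code_prod C D \<Longrightarrow> w \<noteq> 0 \<Longrightarrow> 2 \<le> hweight w"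
  shows "\<exists>(h::nat) (I :: nat \<Rightarrow> 'n set)
        (Cs :: nat \<Rightarrow> ('a ^ 'n) set) (Ds :: nat \<Rightarrow> ('a ^ 'n) set).
        (\<forall>i\<in>{1..h}. I i \<noteq> {}) \<and> disjoint_family_on I {1..h} \<and> (\<Union>i\<in>{1..h}. I i) = UNIV \<and>
        (\<forall>i\<in>{1..h}. vec.subspace (Cs i) \<and> vec.subspace (Ds i) \<and>
           supp (Cs i) = I i \<and> supp (Ds i) = I i) \<and>
        direct_sum {1..h} Cs C \<and> direct_sum {1..h} Ds D \<and>
        (\<forall>i\<in>{1..h}. \<exists>g \<in> I i \<rightarrow>\<^sub>E (UNIV - {0::'a}).
           proj_on (I i) ` Cs i = dual_on (I i) (scale_on (I i) g (proj_on (I i) ` Ds i)))"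
proof -
  define E where "E = {z. \<forall>w\<in>code_prod C D. (\<Sum>j\<in>UNIV. z $ j * w $ j) = 0}"
  have light: "w = 0" if "w \<in> code_prod C D" "vsupp w \<subseteq> {i}" for w i
    using wt[OF that(1)] hweight_le_card[OF that(2)] by auto
  have Efull: "\<exists>z\<in>E. z $ i \<noteq> 0" for i
  proof -
    obtain z where "z $ i \<noteq> 0" "\<forall>x\<in>code_prod C D. (\<Sum>j\<in>UNIV. z $ j * x $ j) = 0"
      using light by (rule exists_dual_vector[OF subspace_code_prod])
    then show ?thesis by (auto simp: E_def)
  qed
  have "x = 0" if "\<forall>i\<in>UNIV. x $ i = 0" for x :: "'a ^ 'n" using that by (simp add: vec_eq_iff)
  then obtain A c where A: "A \<subseteq> UNIV" "dual_family A c" "c ` A \<subseteq> C" "card A = vec.dim C"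
    "\<forall>x\<in>C. x = (\<Sum>a\<in>A. x $ a *s c a)"
    by (rule information_set[OF C])
  \<comment> \<open>Multiplied by the row \<open>c a\<close>, with \<open>a\<close> in its support,
    a vector of \<open>D\<close> vanishing off \<open>A\<close> would leave only the coordinate
    \<open>a\<close>, a word of weight one.\<close>
  have Dinj: "y = 0" if y: "y \<in> D" "\<forall>i\<in>-A. y $ i = 0" for y
  proof (rule ccontr)
    assume "y \<noteq> 0"
    then obtain a where a: "y $ a \<noteq> 0" by (auto simp: vec_eq_iff)
    with y have "a \<in> A" by blast
    have "c a $ i * y $ i = 0" if "i \<noteq> a" for i
      using y(2) A(2) that \<open>a \<in> A\<close> by (cases "i \<in> A") (auto simp: dual_family_def)
    then have "vsupp (c a * y) \<subseteq> {a}" by (auto simp: vsupp_def)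
    then have "c a * y = 0" using \<open>a \<in> A\<close> A(3) y(1) by (intro light times_mem_code_prod) auto
    then have "c a $ a * y $ a = 0" by (metis vector_mult_component zero_index)
    then show False using a \<open>a \<in> A\<close> A(2) by (simp add: dual_family_def)
  qed
  obtain B d where B: "B \<subseteq> - A" "dual_family B d" "d ` B \<subseteq> D" "card B = vec.dim D"
    "\<forall>x\<in>D. x = (\<Sum>b\<in>B. x $ b *s d b)"
    by (rule information_set[OF D Dinj])
  have "card A + card (- A) = CARD('n)" by (metis card_Un_disjoint Compl_disjoint Compl_partition finite)
  then have BA: "B = - A" using B(1,4) A(4) dim by (intro card_subset_eq) auto

  \<comment> \<open>The product of \<open>c a\<close> and \<open>d b\<close> has entries
    \<open>d b $ a\<close> at \<open>a\<close>, \<open>c a $ b\<close> at \<open>b\<close> and zero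
    elsewhere; orthogonality to \<open>E\<close> is the relation \<open>rel\<close>. As some vector
    of \<open>E\<close> is non-zero at \<open>a\<close> and some at \<open>b\<close>, the two
    entries vanish together, and if they are non-zero, every vector of \<open>E\<close> vanishes at
    both or neither of \<open>a\<close> and \<open>b\<close>.\<close>
  have edge: "c a $ b = 0 \<longleftrightarrow> d b $ a = 0" "c a $ b \<noteq> 0 \<Longrightarrow> b \<in> block E a"
    if ab: "a \<in> A" "b \<in> B" for a b
  proof -
    have neq: "a \<noteq> b" using ab BA by auto
    have "c a $ i * d b $ i = 0" if "i \<noteq> a" "i \<noteq> b" for i
      using that ab A(2) B(2) BA by (cases "i \<in> A") (auto simp: dual_family_def)
    then have supp: "vsupp (c a * d b) \<subseteq> {a, b}" by (auto simp: vsupp_def)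
    have mem: "c a * d b \<in> code_prod C D" using ab A(3) B(3) by (intro times_mem_code_prod) auto
    have one: "c a $ a = 1" "d b $ b = 1" using ab A(2) B(2) by (auto simp: dual_family_def)
    have rel: "z $ a * d b $ a + z $ b * c a $ b = 0" if "z \<in> E" for z
    proof -
      have "0 = (\<Sum>j\<in>UNIV. z $ j * (c a * d b) $ j)" using that mem by (auto simp: E_def)
      also have "\<dots> = (\<Sum>j\<in>{a, b}. z $ j * (c a * d b) $ j)"
        using supp by (intro sum.mono_neutral_right) (auto simp: vsupp_def)
      finally show ?thesis using neq one by simp
    qed
    show "c a $ b = 0 \<longleftrightarrow> d b $ a = 0"
      using rel Efull[of a] Efull[of b] by fastforce
    then show "b \<in> block E a" if "c a $ b \<noteq> 0"
      using rel that unfolding block_def by (auto; fastforce)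
  qed
  have cblock: "vsupp (c a) \<subseteq> block E a" if "a \<in> A" for a
  proof
    fix j assume "j \<in> vsupp (c a)"
    then show "j \<in> block E a"
      using edge(2)[OF that, of j] that BA A(2) by (cases "j \<in> A") (auto simp: vsupp_def dual_family_def split: if_splits)
  qed
  have dblock: "vsupp (d b) \<subseteq> block E b" if "b \<in> B" for b
  proof
    fix j assume j: "j \<in> vsupp (d b)"
    show "j \<in> block E b"
    proof (cases "j \<in> B")
      case True
      then show ?thesis using j that B(2) by (auto simp: vsupp_def dual_family_def split: if_splits)
    next
      case False
      then have "j \<in> A" using BA by auto
      then have "b \<in> block E j" using edge[OF _ that, of j] j by (auto simp: vsupp_def)
      then show ?thesis by (auto simp: block_def)
    qed
  qed
  \<comment> \<open>Each basis row lives in a single block, so masking by a block keeps or kills it;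
    hence both codes are stable under masking.\<close>
  have mask_basis: "ind (block E i) * v = (if a \<in> block E i then v else 0)"
    if "vsupp v \<subseteq> block E a" for v :: "'a ^ 'n" and i a
  proof (cases "a \<in> block E i")
    case True
    then show ?thesis using that block_eqI ind_times_eq by metis
  next
    case False
    have "j \<notin> block E i" if "j \<in> block E a" for j
      using that False block_eqI self_in_block by metis
    then have "ind (block E i) * v = 0" using that by (auto simp: vec_eq_iff vsupp_def)
    then show ?thesis using False by simp
  qed
  have maskC: "ind (block E i) * x \<in> C" if x: "x \<in> C" for x i
  proof -
    have "ind (block E i) * x = (\<Sum>a\<in>A. x $ a *s (ind (block E i) * c a))"
      by (subst bspec[OF A(5) x]) (simp add: sum_distrib_left vec_eq_iff algebra_simps)
    then show ?thesis using A(3) C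
      by (auto simp: mask_basis[OF cblock] intro!: vec.subspace_sum vec.subspace_scale vec.subspace_0)
  qed
  have maskD: "ind (block E i) * x \<in> D" if x: "x \<in> D" for x i
  proof -
    have "ind (block E i) * x = (\<Sum>a\<in>B. x $ a *s (ind (block E i) * d a))"
      by (subst bspec[OF B(5) x]) (simp add: sum_distrib_left vec_eq_iff algebra_simps)
    then show ?thesis using B(3) D
      by (auto simp: mask_basis[OF dblock] intro!: vec.subspace_sum vec.subspace_scale vec.subspace_0)
  qed

  obtain f where f: "bij_betw f {1..card (range (block E))} (range (block E))"
    using ex_bij_betw_nat_finite_1[of "range (block E)"] by auto
  let ?h = "card (range (block E))"
  let ?Cs = "\<lambda>i. {x \<in> C. vsupp x \<subseteq> f i}" and ?Ds = "\<lambda>i. {x \<in> D. vsupp x \<subseteq> f i}"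
  have f_range: "\<exists>j. f i = block E j" if "i \<in> {1..?h}" for i
    using bij_betwE[OF f] that by blast
  have sub: "vec.subspace {x \<in> S. vsupp x \<subseteq> J}" if "vec.subspace S" for S :: "('a ^ 'n) set" and J
  proof -
    have "{x \<in> S. vsupp x \<subseteq> J} = {x \<in> S. \<forall>i\<in>-J. x $ i = 0}" by (auto simp: vsupp_def)
    then show ?thesis using subspace_vanishing[OF that] by simp
  qed
  have suppS: "supp {x \<in> S. vsupp x \<subseteq> block E j} = block E j"
    if S: "supp S = UNIV" "\<And>x. x \<in> S \<Longrightarrow> ind (block E j) * x \<in> S" for S :: "('a ^ 'n) set" and j
  proof
    show "supp {x \<in> S. vsupp x \<subseteq> block E j} \<subseteq> block E j" by (auto simp: supp_def)
    show "block E j \<subseteq> supp {x \<in> S. vsupp x \<subseteq> block E j}"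
    proof
      fix k assume k: "k \<in> block E j"
      obtain x where "x \<in> S" "x $ k \<noteq> 0" using S(1) mem_supp_iff[of k S] by auto
      then show "k \<in> supp {x \<in> S. vsupp x \<subseteq> block E j}"
        unfolding mem_supp_iff using S(2) k
        by (intro bexI[of _ "ind (block E j) * x"]) (auto simp: vsupp_ind_times)
    qed
  qed
  have disj: "disjoint_family_on f {1..?h}"
    unfolding disjoint_family_on_def
  proof (intro ballI impI)
    fix m n assume mn: "m \<in> {1..?h}" "n \<in> {1..?h}" "m \<noteq> n"
    then have "f m \<noteq> f n" using f by (meson bij_betw_imp_inj_on inj_onD)
    obtain i j where "f m = block E i" "f n = block E j" using f_range mn(1,2) by meson
    with \<open>f m \<noteq> f n\<close> show "f m \<inter> f n = {}"
      using block_eqI[of _ E i] block_eqI[of _ E j] by (metis disjoint_iff)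
  qed
  have cover: "(\<Union>i\<in>{1..?h}. f i) = UNIV"
  proof -
    have "f ` {1..?h} = range (block E)" using f by (simp only: bij_betw_def)
    moreover have "\<Union>(range (block E)) = UNIV" using self_in_block by auto
    ultimately show ?thesis by (simp only:)
  qed
  have dual: "\<exists>g \<in> J \<rightarrow>\<^sub>E (UNIV - {0}).
       proj_on J ` {x \<in> C. vsupp x \<subseteq> J} = dual_on J (scale_on J g (proj_on J ` {x \<in> D. vsupp x \<subseteq> J}))"
    if J: "J = block E k" for J k
  proof -
    obtain z where z: "z \<in> E" "z $ k \<noteq> 0" using Efull by blast
    then have z0: "z $ j \<noteq> 0" if "j \<in> J" for j using J that by (auto simp: block_def)
    let ?g = "\<lambda>j\<in>J. z $ j"
    have orth: "(\<Sum>j\<in>J. x $ j * (z $ j * y $ j)) = 0" if "x \<in> C" "y \<in> D" "vsupp x \<subseteq> J" for x y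
    proof -
      have "(\<Sum>j\<in>J. x $ j * (z $ j * y $ j)) = (\<Sum>j\<in>UNIV. z $ j * (x * y) $ j)"
        using that(3) by (intro sum.mono_neutral_cong_left) (auto simp: vsupp_def)
      then show ?thesis using z(1) times_mem_code_prod[OF that(1,2)] by (auto simp: E_def)
    qed
    have "proj_on J ` {x \<in> C. vsupp x \<subseteq> J} = dual_on J (scale_on J ?g (proj_on J ` {x \<in> D. vsupp x \<subseteq> J}))"
    proof
      show "proj_on J ` {x \<in> C. vsupp x \<subseteq> J} \<subseteq> dual_on J (scale_on J ?g (proj_on J ` {x \<in> D. vsupp x \<subseteq> J}))"
        using orth by (auto simp: dual_on_def scale_on_def proj_on_def)
      show "dual_on J (scale_on J ?g (proj_on J ` {x \<in> D. vsupp x \<subseteq> J})) \<subseteq> proj_on J ` {x \<in> C. vsupp x \<subseteq> J}"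
      proof
        fix x assume "x \<in> dual_on J (scale_on J ?g (proj_on J ` {x \<in> D. vsupp x \<subseteq> J}))"
        then have x: "x \<in> J \<rightarrow>\<^sub>E UNIV"
          "\<And>y. y \<in> D \<Longrightarrow> vsupp y \<subseteq> J \<Longrightarrow> (\<Sum>j\<in>J. x j * (z $ j * y $ j)) = 0"
          by (auto simp: dual_on_def scale_on_def proj_on_def)
        \<comment> \<open>The word of \<open>C\<close> that interpolates \<open>x\<close> on
          \<open>A \<inter> J\<close>. It lies in the block, and pairing its difference from
          \<open>x\<close> with \<open>d b\<close>, which vanishes on the rest of \<open>B\<close>,
          isolates coordinate \<open>b\<close>.\<close>
        define c0 where "c0 = (\<Sum>a\<in>A \<inter> J. x a *s c a)"
        have c0: "c0 \<in> C" unfolding c0_def using A(3) C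
          by (intro vec.subspace_sum vec.subspace_scale) auto
        have "vsupp (c a) \<subseteq> J" if "a \<in> A \<inter> J" for a
          using that cblock[of a] block_eqI[of a E k] J by auto
        then have "x a * c a $ j = 0" if "a \<in> A \<inter> J" "j \<notin> J" for a j
          using that by (fastforce simp: vsupp_def)
        then have "c0 $ j = 0" if "j \<notin> J" for j
          unfolding c0_def sum_component vector_smult_component using that
          by (intro sum.neutral) blast
        then have c0J: "vsupp c0 \<subseteq> J" by (auto simp: vsupp_def)
        have c0A: "c0 $ a = x a" if "a \<in> A" "a \<in> J" for a
          unfolding c0_def using that A(2)
          by (intro dual_family_comb) (auto simp: dual_family_def)
        have "c0 $ b = x b" if b: "b \<in> J" "b \<notin> A" for b
        proof -
          have bB: "b \<in> B" using b BA by auto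
          have db: "d b \<in> D" "vsupp (d b) \<subseteq> J"
            using bB B(3) dblock[of b] block_eqI[of b E k] J b by auto
          have "0 = (\<Sum>j\<in>J. c0 $ j * (z $ j * d b $ j)) - (\<Sum>j\<in>J. x j * (z $ j * d b $ j))"
            using orth[OF c0 db(1) c0J] x(2)[OF db] by simp
          also have "\<dots> = (\<Sum>j\<in>J. (c0 $ j - x j) * (z $ j * d b $ j))"
            by (simp add: sum_subtractf left_diff_distrib)
          also have "\<dots> = (\<Sum>j\<in>{b}. (c0 $ j - x j) * (z $ j * d b $ j))"
          proof (intro sum.mono_neutral_right ballI)
            fix j assume "j \<in> J - {b}"
            then show "(c0 $ j - x j) * (z $ j * d b $ j) = 0"
              using c0A[of j] B(2) bB BA by (cases "j \<in> A") (auto simp: dual_family_def)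
          qed (use b in auto)
          also have "\<dots> = (c0 $ b - x b) * z $ b" using bB B(2) by (simp add: dual_family_def)
          finally show ?thesis using z0[OF b(1)] by auto
        qed
        with c0A have "c0 $ j = x j" if "j \<in> J" for j using that by blast
        then have "x j = proj_on J c0 j" for j
          using PiE_arb[OF x(1)] by (cases "j \<in> J") (simp_all add: proj_on_def)
        then have "x = proj_on J c0" by (rule ext)
        then show "x \<in> proj_on J ` {x \<in> C. vsupp x \<subseteq> J}" using c0 c0J by blast
      qed
    qed
    then show ?thesis using z0 by (intro bexI[of _ ?g]) auto
  qed
  have mask: "ind (f i) * x \<in> C" if "i \<in> {1..?h}" "x \<in> C" for i x
    using f_range[OF that(1)] maskC[OF that(2)] by auto
  have mask': "ind (f i) * x \<in> D" if "i \<in> {1..?h}" "x \<in> D" for i x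
    using f_range[OF that(1)] maskD[OF that(2)] by auto
  have sumC: "direct_sum {1..?h} ?Cs C"
    by (intro direct_sum_masks C disj cover mask) auto
  have sumD: "direct_sum {1..?h} ?Ds D"
    by (intro direct_sum_masks D disj cover mask') auto
  have ne: "\<forall>i\<in>{1..?h}. f i \<noteq> {}"
    using f_range self_in_block by (metis empty_iff)
  have codes: "\<forall>i\<in>{1..?h}. vec.subspace (?Cs i) \<and> vec.subspace (?Ds i) \<and> supp (?Cs i) = f i \<and> supp (?Ds i) = f i"
  proof
    fix i assume "i \<in> {1..?h}"
    then obtain j where j: "f i = block E j" using f_range by meson
    show "vec.subspace (?Cs i) \<and> vec.subspace (?Ds i) \<and> supp (?Cs i) = f i \<and> supp (?Ds i) = f i"
      unfolding j by (intro conjI sub C D suppS full maskC maskD)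
  qed
  have duals: "\<forall>i\<in>{1..?h}. \<exists>g \<in> f i \<rightarrow>\<^sub>E (UNIV - {0}).
       proj_on (f i) ` ?Cs i = dual_on (f i) (scale_on (f i) g (proj_on (f i) ` ?Ds i))"
    using f_range dual by meson
  show ?thesis
    by (rule exI[of _ ?h], rule exI[of _ f], rule exI[of _ ?Cs], rule exI[of _ ?Ds])
      (intro conjI ne disj cover codes sumC sumD duals)
qed

section \<open>The product Singleton bound and MDS codes\<close>

text \<open>Let \<open>P \<subseteq> T\<close> omit \<open>d - 2\<close> points of \<open>T\<close>.
  A product whose support meets \<open>P\<close> in at most one point is too light, hence zero. With
  no point, this shows that both codes inject into \<open>P\<close>; with one point, that no
  non-zero vector of \<open>D\<close> vanishes on \<open>P - A\<close>, for an information set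
  \<open>A \<subseteq> P\<close> of \<open>C\<close>. So
  \<open>dim D \<le> card P - dim C\<close>.\<close>

lemma product_singleton_bound:
  fixes C D :: "('a::field ^ 'n::finite) set"
  assumes C: "vec.subspace C" and D: "vec.subspace D"
    and supp: "supp C = T" "supp D = T" "T \<noteq> {}" and d: "2 \<le> d"
    and wt: "\<And>x y. x \<in> C \<Longrightarrow> y \<in> D \<Longrightarrow> x * y \<noteq> 0 \<Longrightarrow> d \<le> hweight (x * y)"
  shows "vec.dim C + vec.dim D + d \<le> card T + 2"
proof -
  have zero: "x * y = 0" if "x \<in> C" "y \<in> D" "vsupp (x * y) \<subseteq> S" "card S < d" for x y S
    using wt[OF that(1,2)] hweight_le_card[OF that(3)] that(4) by fastforce
  have prodT: "vsupp (x * y) \<subseteq> T" if "y \<in> D" for x y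
    using that supp(2) by (auto simp: supp_def vsupp_def)
  have "d \<le> card T"
  proof (rule ccontr)
    assume "\<not> d \<le> card T"
    then have "x * y = 0" if "x \<in> C" "y \<in> D" for x y using zero[OF that prodT] that by auto
    moreover obtain t where "t \<in> T" using supp(3) by auto
    then obtain x y where "x \<in> C" "x $ t \<noteq> 0" "y \<in> D" "y $ t \<noteq> 0" using supp mem_supp_iff by metis
    ultimately show False by (metis mult_eq_0_iff vector_mult_component zero_index)
  qed
  then obtain P where P: "P \<subseteq> T" "card P = card T - (d - 2)"
    by (meson diff_le_self obtain_subset_with_card_n)
  then have TP: "card (T - P) = d - 2" using \<open>d \<le> card T\<close> by (simp add: card_Diff_subset)
  have injC: "x = 0" if x: "x \<in> C" "\<forall>i\<in>P. x $ i = 0" for x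
  proof (rule ccontr)
    assume "x \<noteq> 0"
    then obtain i where i: "x $ i \<noteq> 0" by (auto simp: vec_eq_iff)
    then obtain y where y: "y \<in> D" "y $ i \<noteq> 0" using x supp mem_supp_iff by metis
    have "x * y = 0"
      using x y(1) prodT[of y x] TP d by (intro zero[of _ _ "T - P"]) (auto simp: vsupp_def)
    then show False using i y by (metis mult_eq_0_iff vector_mult_component zero_index)
  qed
  have injD: "y = 0" if y: "y \<in> D" "\<forall>i\<in>P. y $ i = 0" for y
  proof (rule ccontr)
    assume "y \<noteq> 0"
    then obtain i where i: "y $ i \<noteq> 0" by (auto simp: vec_eq_iff)
    then obtain x where x: "x \<in> C" "x $ i \<noteq> 0" using y supp mem_supp_iff by metis
    have "x * y = 0"
      using x(1) y prodT[of y x] TP d by (intro zero[of _ _ "T - P"]) (auto simp: vsupp_def)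
    then show False using i x by (metis mult_eq_0_iff vector_mult_component zero_index)
  qed
  obtain A c where A: "A \<subseteq> P" "dual_family A c" "c ` A \<subseteq> C" "card A = vec.dim C"
    "\<forall>x\<in>C. x = (\<Sum>a\<in>A. x $ a *s c a)"
    by (rule information_set[OF C injC])
  have "\<not> card (P - A) < vec.dim D"
  proof
    assume "card (P - A) < vec.dim D"
    then obtain y where y: "y \<in> D" "y \<noteq> 0" "\<forall>i\<in>P - A. y $ i = 0" by (rule obtain_vanishing[OF D])
    then obtain a where a: "a \<in> A" "y $ a \<noteq> 0" using injD by blast
    have ca: "c a \<in> C" using A(3) a(1) by auto
    have "c a $ i * y $ i = 0" if "i \<in> P" "i \<noteq> a" for i
      using A(2) a(1) y(3) that by (cases "i \<in> A") (auto simp: dual_family_def)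
    then have "vsupp (c a * y) \<subseteq> insert a (T - P)"
      using prodT[OF y(1), of "c a"] by (auto simp: vsupp_def)
    then have "c a * y = 0" by (rule zero[OF ca y(1)]) (use TP d in \<open>auto simp: card_insert_if\<close>)
    then have "c a $ a * y $ a = 0" by (metis vector_mult_component zero_index)
    then show False using a A(2) by (simp add: dual_family_def)
  qed
  moreover have "card (P - A) = card P - vec.dim C" "vec.dim C \<le> card P"
    using A(4) card_Diff_subset[OF finite A(1)] card_mono[OF finite A(1)] by simp_all
  ultimately show ?thesis using P(2) \<open>d \<le> card T\<close> d by linarith
qed

lemma supp_ind_times: "supp ((*) (ind J) ` C) = supp C \<inter> J"
  by (auto simp: supp_def vsupp_ind_times)

text \<open>Vectors of \<open>B\<close> live on \<open>supp B\<close>, so cutting \<open>C\<close>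
  down to that set does not change their products, and the bound applies to two codes of support
  \<open>supp B\<close>.\<close>

lemma masked_singleton_bound:
  fixes C D :: "('a::field ^ 'n::finite) set"
  assumes C: "vec.subspace C" and full: "supp C = UNIV"
    and B: "vec.subspace B" "B \<subseteq> D" "\<not> B \<subseteq> {0}" and d: "2 \<le> d"
    and wt: "\<And>x y. x \<in> C \<Longrightarrow> y \<in> D \<Longrightarrow> x * y \<noteq> 0 \<Longrightarrow> d \<le> hweight (x * y)"
  shows "vec.dim ((*) (ind (supp B)) ` C) + vec.dim B + d \<le> card (supp B) + 2"
proof (rule product_singleton_bound[OF subspace_times[OF C] B(1)])
  show "supp ((*) (ind (supp B)) ` C) = supp B" using full by (simp add: supp_ind_times)
  show "supp B \<noteq> {}" using B(3) by (auto simp: supp_def vsupp_def vec_eq_iff)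
  fix x y assume x: "x \<in> (*) (ind (supp B)) ` C" and y: "y \<in> B" and "x * y \<noteq> 0"
  obtain x' where x': "x = ind (supp B) * x'" "x' \<in> C" using x by auto
  have "ind (supp B) * y = y" using y by (intro ind_times_eq) (auto simp: supp_def)
  then have "x * y = x' * y" using x' by (simp add: mult.assoc mult.left_commute)
  then show "d \<le> hweight (x * y)" using wt[of x' y] x' y B(2) \<open>x * y \<noteq> 0\<close> by auto
qed (use d in auto)

lemma subspace_annihilator:
  "vec.subspace D \<Longrightarrow> vec.subspace {y \<in> D. m * y = (0 :: 'a::field ^ 'n)}"
  by (auto simp: vec.subspace_def vec_eq_iff distrib_left mult.left_commute) (metis add.right_neutral)+

text \<open>The masked bounds on the disjoint sets \<open>T\<close> and \<open>U\<close> add up to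
  \<open>dim C + dim D + 2 * d \<le> n + 4\<close>, against \<open>dim C + dim D + d = n + 2\<close>
  and \<open>3 \<le> d\<close>.\<close>

lemma product_MDS_hweight:
  fixes C D :: "('a::field ^ 'n::finite) set"
  assumes C: "vec.subspace C" and D: "vec.subspace D"
    and full: "supp C = UNIV" "supp D = UNIV" and d: "3 \<le> d"
    and wt: "\<And>x y. x \<in> C \<Longrightarrow> y \<in> D \<Longrightarrow> x * y \<noteq> 0 \<Longrightarrow> d \<le> hweight (x * y)"
    and dim: "d + vec.dim C + vec.dim D = CARD('n) + 2"
    and x: "x \<in> C" "x \<noteq> 0"
  shows "CARD('n) + 1 \<le> vec.dim C + hweight x"
proof (rule ccontr)
  assume contr: "\<not> ?thesis"
  have wt': "d \<le> hweight (x * y)" if "x \<in> D" "y \<in> C" "x * y \<noteq> 0" for x y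
    using wt[of y x] that by (simp add: mult.commute)
  define W where "W = vsupp x"
  have d2: "2 \<le> d" using d by simp
  have spanx: "supp (vec.span {x}) = W" "vec.dim (vec.span {x}) = 1"
    "vec.span {x} \<subseteq> C" "\<not> vec.span {x} \<subseteq> {0}"
  proof -
    show "supp (vec.span {x}) = W"
      by (auto simp: supp_def W_def vsupp_def vec.span_singleton intro: exI[of _ 1])
    show "vec.dim (vec.span {x}) = 1" using x(2) by simp
    show "vec.span {x} \<subseteq> C" using x(1) C by (simp add: vec.span_minimal)
    show "\<not> vec.span {x} \<subseteq> {0}" using x(2) vec.span_base[of x "{x}"] by auto
  qed
  \<comment> \<open>Pairing \<open>D\<close> with the line through the light word \<open>x\<close>
    bounds the dimension of \<open>D\<close> on \<open>W\<close>, and so forces non-zero words of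
    \<open>D\<close> that vanish on \<open>W\<close>.\<close>
  have "vec.dim ((*) (ind W) ` D) + 1 + d \<le> card W + 2"
    using masked_singleton_bound[OF D full(2) vec.subspace_span spanx(3,4) d2 wt']
    unfolding spanx(1,2) .
  define B where "B = {y \<in> D. ind W * y = 0}"
  have B: "vec.subspace B" unfolding B_def by (rule subspace_annihilator[OF D])
  have "vec.dim D \<le> vec.dim ((*) (ind W) ` D) + vec.dim B"
    unfolding B_def by (rule dim_le_image_kernel[OF D linear_times])
  then have "0 < vec.dim B"
    using \<open>_ + 1 + d \<le> _\<close> contr dim by (simp add: W_def hweight_def)
  then have B0: "\<not> B \<subseteq> {0}" by (metis vec.dim_eq_0 less_irrefl)
  define T where "T = supp B"
  define A where "A = {x \<in> C. ind T * x = 0}"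
  have A: "vec.subspace A" unfolding A_def by (rule subspace_annihilator[OF C])
  have TW: "T \<inter> W = {}"
    by (auto simp: T_def B_def supp_def vsupp_def vec_eq_iff)
  then have xA: "x \<in> A" using x(1) by (auto simp: A_def vec_eq_iff W_def vsupp_def)
  define U where "U = supp A"
  have TU: "T \<inter> U = {}"
    by (auto simp: U_def A_def supp_def vsupp_def vec_eq_iff)
  have WU: "W \<subseteq> U" using xA by (auto simp: W_def U_def supp_def)
  \<comment> \<open>Although defined by vanishing on \<open>W\<close>, \<open>B\<close> is also the
    subcode of \<open>D\<close> vanishing on the larger set \<open>U\<close>. So \<open>A\<close>
    and \<open>B\<close> are the kernels in the two dimension counts.\<close>
  have B_eq: "{y \<in> D. ind U * y = 0} = B"
  proof
    show "{y \<in> D. ind U * y = 0} \<subseteq> B" using WU by (auto simp: B_def vec_eq_iff)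
    have "y $ i = 0" if "y \<in> B" "i \<in> U" for y i
      using TU that mem_supp_iff[of i B] by (auto simp: T_def)
    then have "ind U * y = 0" if "y \<in> B" for y using that by (simp add: vec_eq_iff)
    moreover have "B \<subseteq> D" by (auto simp: B_def)
    ultimately show "B \<subseteq> {y \<in> D. ind U * y = 0}" by blast
  qed
  have "vec.dim C \<le> vec.dim ((*) (ind T) ` C) + vec.dim A"
    unfolding A_def by (rule dim_le_image_kernel[OF C linear_times])
  moreover have "vec.dim D \<le> vec.dim ((*) (ind U) ` D) + vec.dim B"
    using dim_le_image_kernel[OF D linear_times, of "ind U"] by (simp add: B_eq)
  moreover have "vec.dim ((*) (ind T) ` C) + vec.dim B + d \<le> card T + 2"
    unfolding T_def by (rule masked_singleton_bound[OF C full(1) B _ B0 d2 wt]) (auto simp: B_def)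
  moreover have "vec.dim ((*) (ind U) ` D) + vec.dim A + d \<le> card U + 2"
    unfolding U_def using xA x(2)
    by (intro masked_singleton_bound[OF D full(2) A _ _ d2 wt']) (auto simp: A_def)
  moreover have "card T + card U \<le> CARD('n)"
    using TU by (metis card_Un_disjoint card_mono finite subset_UNIV)
  ultimately show False using dim d by linarith
qed

section \<open>From weight bounds to the MDS property\<close>

lemma d_min_le: "x \<in> C \<Longrightarrow> x \<noteq> 0 \<Longrightarrow> d_min C \<le> hweight x"
  by (auto simp: d_min_def intro!: cInf_lower)

text \<open>One inequality is the weight hypothesis; for the other, a row of a systematic basis has
  \<open>dim C - 1\<close> zeros. Positive dimension supplies such a row.\<close>

lemma MDS_hweightI:
  fixes C :: "('a::field ^ 'n::finite) set"
  assumes C: "vec.subspace C" and dim: "0 < vec.dim C"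
    and wt: "\<And>x. x \<in> C \<Longrightarrow> x \<noteq> 0 \<Longrightarrow> CARD('n) + 1 \<le> vec.dim C + hweight x"
  shows "MDS C"
proof -
  have inj: "x = 0" if "x \<in> C" "\<forall>i\<in>UNIV. x $ i = 0" for x using that by (simp add: vec_eq_iff)
  obtain A c where A: "A \<subseteq> UNIV" "dual_family A c" "c ` A \<subseteq> C" "card A = vec.dim C"
    "\<forall>x\<in>C. x = (\<Sum>a\<in>A. x $ a *s c a)"
    by (rule information_set[OF C inj])
  obtain a where a: "a \<in> A" using A(4) dim by (metis card.empty equals0I less_irrefl)
  have ca: "c a \<in> C" using A(3) a by auto
  have "c a $ a = 1" using A(2) a by (simp add: dual_family_def)
  then have ca0: "c a \<noteq> 0" by auto
  have "vsupp (c a) \<subseteq> insert a (- A)" using A(2) a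
    by (auto simp: vsupp_def dual_family_def split: if_splits)
  then have "hweight (c a) \<le> card (insert a (- A))" by (rule hweight_le_card)
  also have "\<dots> = CARD('n) - vec.dim C + 1" using a A(4) by (simp add: Compl_eq_Diff_UNIV card_Diff_subset)
  finally have "d_min C \<le> CARD('n) - vec.dim C + 1" using d_min_le[OF ca ca0] by simp
  moreover have "vec.dim C \<le> CARD('n)" using A(4) by (metis card_mono finite subset_UNIV)
  moreover have "CARD('n) + 1 - vec.dim C \<le> d_min C"
  proof -
    have "CARD('n) + 1 - vec.dim C \<le> Inf (hweight ` (C - {0}))"
      using ca ca0 wt by (intro cInf_greatest) fastforce+
    then show ?thesis using ca ca0 by (auto simp: d_min_def)
  qed
  ultimately show ?thesis unfolding MDS_def by linarith
qed

section \<open>Reed-Solomon codes in homogeneous coordinates\<close>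

text \<open>
  The Reed-Solomon code of dimension \<open>m + 1\<close> with multipliers \<open>h\<^sub>i\<close> and evaluation points
  \<open>(a\<^sub>i : b\<^sub>i)\<close> of the projective line; homogeneous coordinates spare the case distinction at \<open>\<infinity>\<close>.
\<close>

definition rs :: "'a ^ 'n \<Rightarrow> 'a ^ 'n \<Rightarrow> 'a ^ 'n \<Rightarrow> nat \<Rightarrow> ('a::field ^ 'n) set" where
  "rs h a b m = vec.span ((\<lambda>j. h * a ^ j * b ^ (m - j)) ` {..m})"

text \<open>Non-vanishing 2x2 determinants express distinctness of the points
  \<open>(a $ i : b $ i)\<close>. Once \<open>I\<close> has two elements, this also excludes the
  pair \<open>(0, 0)\<close>.\<close>

definition distinct_points :: "'n set \<Rightarrow> 'a::field ^ 'n \<Rightarrow> 'a ^ 'n \<Rightarrow> bool" where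
  "distinct_points I a b \<longleftrightarrow> (\<forall>i\<in>I. \<forall>j\<in>I. i \<noteq> j \<longrightarrow> a $ i * b $ j \<noteq> a $ j * b $ i)"

lemma vec_power_nth: "(a ^ m) $ i = (a $ i :: 'a::comm_ring_1) ^ m"
  by (induction m) simp_all

lemma distinct_points_nonzero:
  assumes "distinct_points I a b" and "2 \<le> card I" and "i \<in> I"
  shows "a $ i \<noteq> 0 \<or> b $ i \<noteq> 0"
proof -
  have "\<not> I \<subseteq> {i}" using assms(2) card_mono[of "{i}" I] by auto
  then obtain j where "j \<in> I" "j \<noteq> i" by auto
  then show ?thesis using assms(1,3) by (fastforce simp: distinct_points_def)
qed

lemma hweight_mono: "vsupp x \<subseteq> vsupp y \<Longrightarrow> hweight x \<le> hweight (y :: 'a::zero ^ 'n::finite)"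
  unfolding hweight_def by (intro card_mono) auto

lemma obtain_subspace_of_dim:
  assumes "vec.subspace S" and "m \<le> vec.dim S"
  obtains T :: "('a::field ^ 'n) set" where "vec.subspace T" "T \<subseteq> S" "vec.dim T = m"
  using vec.choose_subspace_of_subspace[OF assms(2)] assms(1) vec.span_eq_iff by metis

lemma subspace_supported: "vec.subspace {y :: 'a::field ^ 'n. vsupp y \<subseteq> I}"
  using subspace_vanishing[OF vec.subspace_UNIV, of "- I"]
  by (simp add: vsupp_def subset_iff Ball_def imp_conv_disj disj_commute)

text \<open>As \<open>a D + b D\<close> has dimension at most \<open>dim D + 1\<close>, the spaces
  \<open>a D\<close> and \<open>b D\<close> meet in dimension at least \<open>dim D - 1\<close>. A
  common vector \<open>a * u = b * v\<close> factors as \<open>a * b * y\<close> with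
  \<open>a * y = v\<close> and \<open>b * y = u\<close>. The vectors \<open>y\<close> contain the
  next code, for which \<open>D\<close> takes over the role of \<open>W\<close>.\<close>

lemma exists_geometric_family:
  fixes D W :: "('a::field ^ 'n::finite) set"
  assumes pts: "distinct_points I a b" and I: "2 \<le> card I"
  shows "\<lbrakk>vec.subspace D; vec.dim D = Suc m; \<And>x. x \<in> D \<Longrightarrow> vsupp x \<subseteq> I;
    \<And>x. x \<in> D \<Longrightarrow> x \<noteq> 0 \<Longrightarrow> 2 \<le> hweight x; vec.subspace W;
    \<And>x. x \<in> D \<Longrightarrow> a * x \<in> W \<and> b * x \<in> W; vec.dim W \<le> m + 2\<rbrakk>
    \<Longrightarrow> \<exists>h. h \<noteq> 0 \<and> vsupp h \<subseteq> I \<and> (\<forall>j\<le>m. h * a ^ j * b ^ (m - j) \<in> D)"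
proof (induction m arbitrary: D W)
  case 0
  then obtain h where "h \<in> D" "h \<noteq> 0" using obtain_nonzero[of D] by (metis zero_less_Suc)
  then show ?case using 0(3) by auto
next
  case (Suc m)
  note nz = distinct_points_nonzero[OF pts I]
  \<comment> \<open>As the points are distinct, \<open>a\<close> and \<open>b\<close> vanish at most
    once each on \<open>I\<close>, too rarely to kill a word of weight at least two.\<close>
  have inj: "x = 0" if x: "x \<in> D" "c * x = 0" and c: "c = a \<or> c = b" for x c
  proof (rule ccontr)
    assume "x \<noteq> 0"
    then obtain i where i: "x $ i \<noteq> 0" by (auto simp: vec_eq_iff)
    have "vsupp x \<subseteq> {j \<in> I. c $ j = 0}" using Suc.prems(3)[OF x(1)] x(2)
      by (auto simp: vec_eq_iff vsupp_def)
    moreover have "j = k" if "j \<in> {j \<in> I. c $ j = 0}" "k \<in> {j \<in> I. c $ j = 0}" for j k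
      using that c pts[unfolded distinct_points_def, rule_format, of j k] by (cases "j = k") auto
    moreover have "i \<in> vsupp x" using i by (simp add: vsupp_def)
    ultimately have "vsupp x \<subseteq> {i}" by blast
    then show False using hweight_le_card[of x "{i}"] Suc.prems(4)[OF x(1) \<open>x \<noteq> 0\<close>] by simp
  qed
  define X where "X = (*) a ` D"
  define Y where "Y = (*) b ` D"
  have XY: "vec.subspace X" "vec.subspace Y" "vec.dim X = m + 2" "vec.dim Y = m + 2"
    unfolding X_def Y_def
    using subspace_times[OF Suc.prems(1)] dim_image_inj[OF Suc.prems(1) linear_times inj] Suc.prems(2) by simp_all
  have "{x + y |x y. x \<in> X \<and> y \<in> Y} \<subseteq> W"
  proof clarsimp
    fix x y assume "x \<in> X" "y \<in> Y"
    then have "x \<in> W" "y \<in> W" using Suc.prems(6) by (auto simp: X_def Y_def)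
    then show "x + y \<in> W" by (rule vec.subspace_add[OF Suc.prems(5)])
  qed
  then have "vec.dim {x + y |x y. x \<in> X \<and> y \<in> Y} \<le> vec.dim W" by (rule vec.dim_subset)
  then have "vec.dim {x + y |x y. x \<in> X \<and> y \<in> Y} \<le> m + 3" using Suc.prems(7) by linarith
  then have dXY: "m + 1 \<le> vec.dim (X \<inter> Y)"
    using vec.dim_sums_Int[OF XY(1,2)] XY(3,4) by linarith
  define D1 where "D1 = {y. vsupp y \<subseteq> I \<and> a * y \<in> D \<and> b * y \<in> D}"
  have "X \<inter> Y \<subseteq> (*) (a * b) ` D1"
  proof
    fix w assume "w \<in> X \<inter> Y"
    then obtain u v where uv: "u \<in> D" "v \<in> D" "w = a * u" "w = b * v" by (auto simp: X_def Y_def)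
    \<comment> \<open>The quotient of \<open>v\<close> by \<open>a\<close>, or of \<open>u\<close>
      by \<open>b\<close> where \<open>a\<close> vanishes; at each point of \<open>I\<close> one of
      them is defined, and \<open>eq\<close> makes them agree.\<close>
    define y where "y = (\<chi> i. if i \<notin> I then 0 else if a $ i \<noteq> 0 then v $ i / a $ i else u $ i / b $ i)"
    have eq: "a $ i * u $ i = b $ i * v $ i" for i
      using uv(3,4) by (metis vector_mult_component)
    have off: "u $ i = 0" "v $ i = 0" if "i \<notin> I" for i
      using Suc.prems(3) uv(1,2) that by (auto simp: vsupp_def)
    have "(a * y) $ i = v $ i" "(b * y) $ i = u $ i" for i
      using eq[of i] off[of i] nz[of i] by (auto simp: y_def field_simps)
    then have ay: "a * y = v" "b * y = u" by (auto simp: vec_eq_iff)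
    have "vsupp y \<subseteq> I" by (auto simp: y_def vsupp_def split: if_splits)
    then have "y \<in> D1" using ay uv by (simp add: D1_def)
    moreover have "w = a * b * y" using ay uv by (simp add: mult.assoc)
    ultimately show "w \<in> (*) (a * b) ` D1" by blast
  qed
  then have "vec.dim (X \<inter> Y) \<le> vec.dim ((*) (a * b) ` D1)" by (rule vec.dim_subset)
  then have "m + 1 \<le> vec.dim ((*) (a * b) ` D1)" using dXY by linarith
  also have "\<dots> \<le> vec.dim D1" by (rule vec.dim_image_le[OF linear_times])
  finally have dD1: "m + 1 \<le> vec.dim D1" .
  have s1: "vec.subspace {y. c * y \<in> D}" for c
    using vec.linear_subspace_vimage[OF linear_times Suc.prems(1), of c] by (simp add: vimage_def)
  have "D1 = {y. vsupp y \<subseteq> I} \<inter> {y. a * y \<in> D} \<inter> {y. b * y \<in> D}"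
    by (auto simp: D1_def)
  moreover have "vec.subspace ({y. vsupp y \<subseteq> I} \<inter> {y. a * y \<in> D} \<inter> {y. b * y \<in> D})"
    by (intro vec.subspace_inter subspace_supported s1)
  ultimately have sD1: "vec.subspace D1" by (simp only:)
  have "Suc m \<le> vec.dim D1" using dD1 by simp
  then obtain D2 where D2: "vec.subspace D2" "D2 \<subseteq> D1" "vec.dim D2 = Suc m"
    by (rule obtain_subspace_of_dim[OF sD1])
  have "\<exists>h. h \<noteq> 0 \<and> vsupp h \<subseteq> I \<and> (\<forall>j\<le>m. h * a ^ j * b ^ (m - j) \<in> D2)"
  proof (rule Suc.IH[OF D2(1,3) _ _ Suc.prems(1)])
    show "vsupp x \<subseteq> I" "a * x \<in> D \<and> b * x \<in> D" if "x \<in> D2" for x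
      using that D2(2) by (auto simp: D1_def)
    \<comment> \<open>Multiplying \<open>x\<close> by whichever of \<open>a\<close>,
      \<open>b\<close> is non-zero at a point of its support gives a non-zero word of
      \<open>D\<close> with no larger support.\<close>
    show "2 \<le> hweight x" if x: "x \<in> D2" "x \<noteq> 0" for x
    proof -
      have x1: "vsupp x \<subseteq> I" "a * x \<in> D" "b * x \<in> D" using x D2(2) by (auto simp: D1_def)
      obtain i where i: "x $ i \<noteq> 0" using x(2) by (auto simp: vec_eq_iff)
      then have "i \<in> I" using x1(1) by (auto simp: vsupp_def)
      then obtain c where c: "c = a \<or> c = b" "c $ i \<noteq> 0" using nz by blast
      have "(c * x) $ i \<noteq> 0" using c i by simp
      then have "c * x \<noteq> 0" by (metis zero_index)
      then have "2 \<le> hweight (c * x)" using c x1 Suc.prems(4) by blast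
      also have "\<dots> \<le> hweight x" by (rule hweight_mono) (auto simp: vsupp_def)
      finally show ?thesis .
    qed
    show "vec.dim D \<le> m + 2" using Suc.prems(2) by simp
  qed
  then obtain h where h: "h \<noteq> 0" "vsupp h \<subseteq> I" "\<And>j. j \<le> m \<Longrightarrow> h * a ^ j * b ^ (m - j) \<in> D1"
    using D2(2) by blast
  have "h * a ^ j * b ^ (Suc m - j) \<in> D" if "j \<le> Suc m" for j
  proof (cases j)
    case 0
    then show ?thesis using h(3)[of 0] by (auto simp: D1_def algebra_simps)
  next
    case (Suc i)
    then show ?thesis using h(3)[of i] that by (auto simp: D1_def algebra_simps)
  qed
  then show ?case using h(1,2) by blast
qed

lemma rs_times:
  assumes "v \<in> rs h a b m"
  shows "(p *s a + q *s b) * v \<in> rs h a b (Suc m)"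
proof -
  have gen: "h * a ^ j * b ^ (Suc m - j) \<in> rs h a b (Suc m)" if "j \<le> Suc m" for j
    using that unfolding rs_def by (intro vec.span_base) auto
  interpret f: Vector_Spaces.linear "(*s)" "(*s)" "(*) (p *s a + q *s b)" by (rule linear_times)
  have "(p *s a + q *s b) * (h * a ^ j * b ^ (m - j)) \<in> rs h a b (Suc m)" if "j \<le> m" for j
  proof -
    have "(p *s a + q *s b) * (h * a ^ j * b ^ (m - j)) =
      p *s (h * a ^ Suc j * b ^ (Suc m - Suc j)) + q *s (h * a ^ j * b ^ (Suc m - j))"
      using that by (simp add: vec_eq_iff vec_power_nth Suc_diff_le algebra_simps)
    then show ?thesis using gen[of j] gen[of "Suc j"] that
      by (simp add: rs_def vec.span_add vec.span_scale del: power_Suc)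
  qed
  then have "(*) (p *s a + q *s b) ` ((\<lambda>j. h * a ^ j * b ^ (m - j)) ` {..m}) \<subseteq> rs h a b (Suc m)"
    by auto
  then have "(*) (p *s a + q *s b) ` rs h a b m \<subseteq> rs h a b (Suc m)"
    unfolding rs_def f.span_image[symmetric] by (intro vec.span_minimal vec.subspace_span)
  then show ?thesis using assms by blast
qed

lemma vsupp_rs: "x \<in> rs h a b m \<Longrightarrow> vsupp x \<subseteq> vsupp h"
proof -
  have "vec.subspace {x. \<forall>i. h $ i = 0 \<longrightarrow> x $ i = 0}" by (auto simp: vec.subspace_def)
  then have "rs h a b m \<subseteq> {x. \<forall>i. h $ i = 0 \<longrightarrow> x $ i = 0}"
    unfolding rs_def by (intro vec.span_minimal) auto
  then show "x \<in> rs h a b m \<Longrightarrow> vsupp x \<subseteq> vsupp h" by (auto simp: vsupp_def)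
qed

text \<open>Interpolation by products of linear forms: the form with coefficients
  \<open>b $ t\<close> and \<open>- a $ t\<close> vanishes at \<open>t\<close> but, the points being
  distinct, not at \<open>i\<close>. Once \<open>P\<close> is exhausted, \<open>a\<close> or
  \<open>b\<close>, whichever is non-zero at \<open>i\<close>, pads the degree.\<close>

lemma rs_separating:
  fixes a b h :: "'a::field ^ 'n::finite"
  assumes pts: "distinct_points I a b" and I: "2 \<le> card I" and i: "i \<in> I" "h $ i \<noteq> 0"
  shows "P \<subseteq> I - {i} \<Longrightarrow> card P \<le> m \<Longrightarrow> \<exists>v\<in>rs h a b m. v $ i \<noteq> 0 \<and> (\<forall>t\<in>P. v $ t = 0)"
proof (induction m arbitrary: P)
  case 0
  then have "P = {}" using finite_subset by fastforce
  moreover have "h \<in> rs h a b 0" by (simp add: rs_def vec.span_base)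
  ultimately show ?case using i by auto
next
  case (Suc m)
  obtain P' p q where P': "P' \<subseteq> I - {i}" "card P' \<le> m" "p * a $ i + q * b $ i \<noteq> 0"
    "\<forall>t\<in>P - P'. p * a $ t + q * b $ t = 0"
  proof (cases "P = {}")
    case True
    show thesis
      using distinct_points_nonzero[OF pts I i(1)] that[of "{}" 1 0] that[of "{}" 0 1] True by auto
  next
    case False
    then obtain t where t: "t \<in> P" by auto
    then have "t \<in> I" "i \<noteq> t" using Suc.prems(1) by auto
    then have "a $ i * b $ t \<noteq> a $ t * b $ i"
      using i(1) pts by (simp add: distinct_points_def)
    then show thesis using Suc.prems t
      by (intro that[of "P - {t}" "b $ t" "- a $ t"]) (auto simp: algebra_simps)
  qed
  obtain v where v: "v \<in> rs h a b m" "v $ i \<noteq> 0" "\<forall>t\<in>P'. v $ t = 0"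
    using Suc.IH[OF P'(1,2)] by auto
  show ?case
  proof (intro bexI[OF _ rs_times[OF v(1), of p q]] conjI ballI)
    show "((p *s a + q *s b) * v) $ i \<noteq> 0" using v(2) P'(3) by simp
    show "((p *s a + q *s b) * v) $ t = 0" if "t \<in> P" for t using v(3) P'(4) that by (cases "t \<in> P'") auto
  qed
qed

text \<open>The monomials lie in \<open>D\<close>, so it remains to see that they span dimension
  \<open>m + 1\<close>. If \<open>h\<close> had at most \<open>m\<close> points in its support, a
  separating vector would have weight one; on \<open>m + 1\<close> points of the support the
  normalised separating vectors form a dual family.\<close>

lemma rs_eqI:
  fixes D :: "('a::field ^ 'n::finite) set"
  assumes D: "vec.subspace D" "vec.dim D = Suc m" "\<And>x. x \<in> D \<Longrightarrow> x \<noteq> 0 \<Longrightarrow> 2 \<le> hweight x"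
    and pts: "distinct_points I a b" and I: "2 \<le> card I"
    and h: "h \<noteq> 0" "vsupp h \<subseteq> I" "\<forall>j\<le>m. h * a ^ j * b ^ (m - j) \<in> D"
  shows "D = rs h a b m"
proof -
  have sub: "rs h a b m \<subseteq> D" unfolding rs_def using D(1) h(3) by (intro vec.span_minimal) auto
  let ?T = "vsupp h"
  have sep: "\<exists>v\<in>rs h a b m. v $ i \<noteq> 0 \<and> (\<forall>t\<in>P - {i}. v $ t = 0)"
    if "P \<subseteq> ?T" "i \<in> P" "card P \<le> Suc m" for P i
    using that h(2) by (intro rs_separating[OF pts I]) (auto simp: vsupp_def)
  have "Suc m \<le> card ?T"
  proof (rule ccontr)
    assume T: "\<not> Suc m \<le> card ?T"
    obtain i where i: "i \<in> ?T" using h(1) by (auto simp: vsupp_def vec_eq_iff)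
    obtain v where v: "v \<in> rs h a b m" "v $ i \<noteq> 0" "\<forall>t\<in>?T - {i}. v $ t = 0"
      using sep[OF subset_refl i] T by auto
    have "vsupp v \<subseteq> {i}" using vsupp_rs[OF v(1)] v(3) by (auto simp: vsupp_def)
    then have "hweight v \<le> card {i}" by (rule hweight_le_card)
    moreover have "v \<noteq> 0" using v(2) by auto
    ultimately show False using D(3)[of v] sub v(1) by auto
  qed
  then obtain Q where Q: "Q \<subseteq> ?T" "card Q = Suc m" by (meson obtain_subset_with_card_n)
  then have "\<exists>v\<in>rs h a b m. v $ i \<noteq> 0 \<and> (\<forall>t\<in>Q - {i}. v $ t = 0)" if "i \<in> Q" for i
    using sep[OF Q(1) that] by simp
  then obtain v where v: "\<And>i. i \<in> Q \<Longrightarrow> v i \<in> rs h a b m \<and> v i $ i \<noteq> 0 \<and> (\<forall>t\<in>Q - {i}. v i $ t = 0)"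
    by metis
  have "card Q \<le> vec.dim (rs h a b m)"
  proof (rule dual_family_card_le_dim)
    show "dual_family Q (\<lambda>i. (1 / v i $ i) *s v i)" using v by (auto simp: dual_family_def)
    show "(\<lambda>i. (1 / v i $ i) *s v i) ` Q \<subseteq> rs h a b m"
      using v by (auto simp: rs_def intro!: vec.span_scale)
  qed
  then have "vec.dim D \<le> vec.dim (rs h a b m)" using Q D(2) by simp
  then show ?thesis using sub D(1) vec.subspace_dim_equal[of "rs h a b m" D]
    by (simp add: rs_def)
qed

section \<open>Extending a common evaluation-point sequence\<close>

definition dual_in :: "'n set \<Rightarrow> ('a::field ^ 'n) set \<Rightarrow> ('a ^ 'n) set" where
  "dual_in I E = {w. vsupp w \<subseteq> I \<and> (\<forall>z\<in>E. (\<Sum>i\<in>UNIV. z $ i * w $ i) = 0)}"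

lemma subspace_dual_in: "vec.subspace (dual_in I E)"
  using subspace_linear_eqs[OF subspace_supported linear_dot, of I E]
  by (simp add: dual_in_def)

text \<open>A dual vector is determined by its values on \<open>I - A\<close>: pairing with the row
  \<open>c a\<close> expresses its value at \<open>a\<close> through them.\<close>

lemma dim_dual_in_le:
  fixes E :: "('a::field ^ 'n::finite) set"
  assumes E: "vec.subspace E" and supp: "\<And>z. z \<in> E \<Longrightarrow> vsupp z \<subseteq> I"
  shows "vec.dim (dual_in I E) + vec.dim E \<le> card I"
proof -
  have inj: "z = 0" if "z \<in> E" "\<forall>i\<in>I. z $ i = 0" for z
    using supp[OF that(1)] that(2) by (auto simp: vec_eq_iff vsupp_def)
  obtain A c where A: "A \<subseteq> I" "dual_family A c" "c ` A \<subseteq> E" "card A = vec.dim E"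
    "\<forall>x\<in>E. x = (\<Sum>a\<in>A. x $ a *s c a)"
    by (rule information_set[OF E inj])
  have "vec.dim (dual_in I E) \<le> card (I - A)"
  proof (rule dim_le_card_support[OF subspace_dual_in])
    fix w assume w: "w \<in> dual_in I E" "\<forall>i\<in>I - A. w $ i = 0"
    have "w $ a = 0" if a: "a \<in> A" for a
    proof -
      have "c a \<in> E" using a A(3) by auto
      then have "0 = (\<Sum>i\<in>UNIV. c a $ i * w $ i)" using w(1) by (simp add: dual_in_def)
      also have "\<dots> = (\<Sum>i\<in>{a}. c a $ i * w $ i)"
      proof (intro sum.mono_neutral_right ballI)
        fix i assume "i \<in> UNIV - {a}"
        then show "c a $ i * w $ i = 0"
          using w a A(2) by (cases "i \<in> A"; cases "i \<in> I") (auto simp: dual_in_def vsupp_def dual_family_def)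
      qed auto
      also have "\<dots> = w $ a" using a A(2) by (simp add: dual_family_def)
      finally show ?thesis by simp
    qed
    then have "w $ i = 0" for i
      using w by (cases "i \<in> A"; cases "i \<in> I") (auto simp: dual_in_def vsupp_def)
    then show "w = 0" by (simp add: vec_eq_iff)
  qed
  moreover have "card (I - A) + card A = card I"
    using A(1) by (metis card_Diff_subset card_mono finite le_add_diff_inverse2)
  ultimately show ?thesis using A(4) by linarith
qed

text \<open>The products \<open>\<phi> j * \<psi> k\<close> depend on \<open>j + k\<close> alone, so
  they form a Hankel matrix of rank one and both sequences are geometric with a common ratio
  \<open>p : q\<close>. It is \<open>t : 1\<close> if \<open>\<phi> 0\<close> is non-zero; otherwise
  it is \<open>1 : 0\<close> and only the last entries survive.\<close>

lemma rank_one_hankel: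
  fixes \<phi> \<psi> :: "nat \<Rightarrow> 'a::field"
  assumes rec: "\<And>j k. j < m \<Longrightarrow> k < n \<Longrightarrow> \<phi> (Suc j) * \<psi> k = \<phi> j * \<psi> (Suc k)"
    and mn: "0 < m" "0 < n"
    and nz: "\<exists>j\<le>m. \<phi> j \<noteq> 0" "\<exists>k\<le>n. \<psi> k \<noteq> 0"
  shows "\<exists>p q \<mu> \<nu>. (\<forall>j\<le>m. \<phi> j = \<mu> * p ^ j * q ^ (m - j)) \<and> (\<forall>k\<le>n. \<psi> k = \<nu> * p ^ k * q ^ (n - k))"
proof (cases "\<phi> 0 = 0")
  case False
  define t where "t = \<phi> 1 / \<phi> 0"
  have step: "\<psi> (Suc k) = t * \<psi> k" if "k < n" for k
    using rec[OF mn(1) that] False by (simp add: t_def field_simps)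
  have \<psi>: "\<psi> k = \<psi> 0 * t ^ k" if "k \<le> n" for k
    using that by (induction k) (auto simp: step)
  have \<psi>0: "\<psi> 0 \<noteq> 0"
  proof
    assume "\<psi> 0 = 0"
    then have "\<psi> k = 0" if "k \<le> n" for k using \<psi>[OF that] by simp
    then show False using nz(2) by auto
  qed
  have "\<phi> (Suc j) = t * \<phi> j" if "j < m" for j
    using rec[OF that mn(2)] step[OF mn(2)] \<psi>0 by simp
  then have \<phi>: "\<phi> j = \<phi> 0 * t ^ j" if "j \<le> m" for j
    using that by (induction j) auto
  have "\<phi> j = \<phi> 0 * t ^ j * 1 ^ (m - j)" if "j \<le> m" for j
    unfolding power_one mult_1_right by (rule \<phi>[OF that])
  moreover have "\<psi> k = \<psi> 0 * t ^ k * 1 ^ (n - k)" if "k \<le> n" for k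
    unfolding power_one mult_1_right by (rule \<psi>[OF that])
  ultimately show ?thesis by blast
next
  case True
  have \<psi>0: "\<psi> k = 0" if k: "k < n" for k
  proof (rule ccontr)
    assume ne: "\<psi> k \<noteq> 0"
    have "\<phi> j = 0" if "j \<le> m" for j
      using that
    proof (induction j)
      case (Suc j)
      then have "\<phi> (Suc j) * \<psi> k = 0" using rec[of j k] k by simp
      then show ?case using ne by simp
    qed (rule True)
    then show False using nz(1) by auto
  qed
  then have \<psi>n: "\<psi> n \<noteq> 0" using nz(2) by (metis le_neq_implies_less)
  have \<phi>0: "\<phi> j = 0" if "j < m" for j
    using rec[OF that, of "n - 1"] \<psi>0[of "n - 1"] \<psi>n mn(2) by simp
  \<comment> \<open>Here \<open>0 ^ 0 = 1\<close> keeps the entry at \<open>j = m\<close>.\<close>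
  have "\<phi> j = \<phi> m * 1 ^ j * 0 ^ (m - j)" if "j \<le> m" for j using \<phi>0[of j] that by (cases "j = m") auto
  moreover have "\<psi> j = \<psi> n * 1 ^ j * 0 ^ (n - j)" if "j \<le> n" for j using \<psi>0[of j] that by (cases "j = n") auto
  ultimately show ?thesis by blast
qed

lemma span_lift:
  fixes D :: "('a::field ^ 'n::finite) set"
  assumes D: "vec.subspace D" and f: "Vector_Spaces.linear (*s) (*s) f"
    and inj: "\<And>x. x \<in> D \<Longrightarrow> f x = 0 \<Longrightarrow> x = 0"
    and y: "Y \<subseteq> D" and span: "f ` D = vec.span (f ` Y)"
  shows "D = vec.span Y"
proof
  interpret f: Vector_Spaces.linear "(*s)" "(*s)" f by (fact f)
  show sub: "vec.span Y \<subseteq> D" by (rule vec.span_minimal[OF y D])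
  show "D \<subseteq> vec.span Y"
  proof
    fix x assume x: "x \<in> D"
    then have "f x \<in> f ` vec.span Y" using span f.span_image by blast
    then obtain u where u: "u \<in> vec.span Y" "f x = f u" by auto
    then have "x - u = 0" using x sub by (intro inj) (auto simp: f.diff vec.subspace_diff[OF D])
    then show "x \<in> vec.span Y" using u(1) by simp
  qed
qed

text \<open>Undoes the puncturing at \<open>s\<close>. Lifts \<open>y j\<close> and
  \<open>z k\<close> of the monomials span the codes, and orthogonality, with \<open>c\<close>
  non-zero at \<open>s\<close>, makes \<open>y j $ s * z k $ s\<close> a function of
  \<open>j + k\<close>. So the values at \<open>s\<close> are evaluations at a common point, and
  \<open>a\<close>, \<open>b\<close>, \<open>h\<close>, \<open>h'\<close> need only be updated at
  \<open>s\<close>.\<close>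

lemma vosper_step:
  fixes C D E :: "('a::field ^ 'n::finite) set"
  assumes D: "vec.subspace D" and E: "vec.subspace E"
    and s: "s \<in> I" and suppD: "supp D = I" and suppE: "supp E = I" and le: "0 < l" "0 < e"
    and orth: "\<And>y z. y \<in> D \<Longrightarrow> z \<in> E \<Longrightarrow> (\<Sum>i\<in>UNIV. c $ i * y $ i * z $ i) = 0"
    and cs: "c $ s \<noteq> 0"
    and injD: "\<And>y. y \<in> D \<Longrightarrow> ind (I - {s}) * y = 0 \<Longrightarrow> y = 0"
    and injE: "\<And>y. y \<in> E \<Longrightarrow> ind (I - {s}) * y = 0 \<Longrightarrow> y = 0"
    and rsD: "(*) (ind (I - {s})) ` D = rs h a b l" and rsE: "(*) (ind (I - {s})) ` E = rs h' a b e"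
  shows "\<exists>a b h h'. D = rs h a b l \<and> E = rs h' a b e"
proof -
  let ?m = "(*) (ind (I - {s}))"
  define u where "u j = h * a ^ j * b ^ (l - j)" for j
  define v where "v j = h' * a ^ j * b ^ (e - j)" for j
  have "u j \<in> rs h a b l" if "j \<le> l" for j using that by (auto simp: rs_def u_def intro!: vec.span_base)
  then have "\<exists>y. y \<in> D \<and> ?m y = u j" if "j \<le> l" for j using rsD that by (metis imageE)
  then obtain y where y: "\<And>j. j \<le> l \<Longrightarrow> y j \<in> D \<and> ?m (y j) = u j" by metis
  have "v j \<in> rs h' a b e" if "j \<le> e" for j using that by (auto simp: rs_def v_def intro!: vec.span_base)
  then have "\<exists>z. z \<in> E \<and> ?m z = v j" if "j \<le> e" for j using rsE that by (metis imageE)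
  then obtain z where z: "\<And>j. j \<le> e \<Longrightarrow> z j \<in> E \<and> ?m (z j) = v j" by metis
  have Dspan: "D = vec.span (y ` {..l})"
  proof (rule span_lift[OF D linear_times injD])
    have "?m ` y ` {..l} = u ` {..l}" unfolding image_image using y by (intro image_cong) auto
    then show "?m ` D = vec.span (?m ` y ` {..l})" unfolding rsD rs_def u_def by simp
  qed (use y in auto)
  have Espan: "E = vec.span (z ` {..e})"
  proof (rule span_lift[OF E linear_times injE])
    have "?m ` z ` {..e} = v ` {..e}" unfolding image_image using z by (intro image_cong) auto
    then show "?m ` E = vec.span (?m ` z ` {..e})" unfolding rsE rs_def v_def by simp
  qed (use z in auto)
  have vanish: "\<exists>x\<in>Y. x $ s \<noteq> 0" if "s \<in> supp (vec.span Y)" for Y :: "('a ^ 'n) set"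
  proof (rule ccontr)
    assume "\<not> ?thesis"
    moreover have "vec.subspace {x :: 'a ^ 'n. x $ s = 0}" by (auto simp: vec.subspace_def)
    ultimately have "vec.span Y \<subseteq> {x. x $ s = 0}" by (intro vec.span_minimal) auto
    then show False using that by (auto simp: mem_supp_iff)
  qed
  have coord: "y j $ i = u j $ i" if "j \<le> l" "i \<noteq> s" for j i
  proof (cases "i \<in> I")
    case True
    then show ?thesis using y[OF that(1)] that(2) by (metis (no_types) Diff_iff ind_nth mult_1 singletonD vector_mult_component)
  next
    case False
    then have "y j $ i = 0" using y[OF that(1)] suppD mem_supp_iff by metis
    moreover have "u j $ i = 0" using y[OF that(1)] \<open>y j $ i = 0\<close> by (metis mult_zero_right vector_mult_component)
    ultimately show ?thesis by simp
  qed
  have coord': "z j $ i = v j $ i" if "j \<le> e" "i \<noteq> s" for j i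
  proof (cases "i \<in> I")
    case True
    then show ?thesis using z[OF that(1)] that(2) by (metis (no_types) Diff_iff ind_nth mult_1 singletonD vector_mult_component)
  next
    case False
    then have "z j $ i = 0" using z[OF that(1)] suppE mem_supp_iff by metis
    moreover have "v j $ i = 0" using z[OF that(1)] \<open>z j $ i = 0\<close> by (metis mult_zero_right vector_mult_component)
    ultimately show ?thesis by simp
  qed
  \<comment> \<open>Minus the contribution of the coordinates other than \<open>s\<close>; the
    exponents of \<open>a $ i\<close> and \<open>b $ i\<close> add up to \<open>l + e\<close>, so
    only \<open>j + k\<close> matters.\<close>
  define \<Lambda> where "\<Lambda> t = - (\<Sum>i\<in>UNIV - {s}. c $ i * h $ i * h' $ i * (a $ i) ^ t * (b $ i) ^ (l + e - t))" for t
  have hankel: "c $ s * y j $ s * z k $ s = \<Lambda> (j + k)" if jk: "j \<le> l" "k \<le> e" for j k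
  proof -
    have "0 = (\<Sum>i\<in>UNIV. c $ i * y j $ i * z k $ i)" using orth y[OF jk(1)] z[OF jk(2)] by auto
    also have "\<dots> = c $ s * y j $ s * z k $ s + (\<Sum>i\<in>UNIV - {s}. c $ i * y j $ i * z k $ i)"
      by (simp add: sum.remove[of UNIV s])
    also have "(\<Sum>i\<in>UNIV - {s}. c $ i * y j $ i * z k $ i) = - \<Lambda> (j + k)"
    proof -
      have "c $ i * u j $ i * v k $ i = c $ i * h $ i * h' $ i * (a $ i) ^ (j + k) * (b $ i) ^ (l + e - (j + k))" for i
      proof -
        have "l + e - (j + k) = (l - j) + (e - k)" using jk by simp
        then show ?thesis by (simp add: u_def v_def vec_power_nth power_add)
      qed
      then show ?thesis unfolding \<Lambda>_def minus_minus using coord[OF jk(1)] coord'[OF jk(2)]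
        by (intro sum.cong refl) simp
    qed
    finally show ?thesis by simp
  qed
  have "\<exists>p q \<mu> \<nu>. (\<forall>j\<le>l. y j $ s = \<mu> * p ^ j * q ^ (l - j)) \<and> (\<forall>k\<le>e. z k $ s = \<nu> * p ^ k * q ^ (e - k))"
  proof (rule rank_one_hankel[OF _ le])
    show "y (Suc j) $ s * z k $ s = y j $ s * z (Suc k) $ s" if "j < l" "k < e" for j k
    proof -
      have "c $ s * (y (Suc j) $ s * z k $ s) = c $ s * (y j $ s * z (Suc k) $ s)"
        using hankel[of "Suc j" k] hankel[of j "Suc k"] that by (simp add: mult.assoc)
      then show ?thesis using cs by simp
    qed
    show "\<exists>j\<le>l. y j $ s \<noteq> 0" using vanish[of "y ` {..l}"] Dspan suppD s by auto
    show "\<exists>k\<le>e. z k $ s \<noteq> 0" using vanish[of "z ` {..e}"] Espan suppE s by auto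
  qed
  then obtain p q \<mu> \<nu> where pq: "\<And>j. j \<le> l \<Longrightarrow> y j $ s = \<mu> * p ^ j * q ^ (l - j)"
    "\<And>k. k \<le> e \<Longrightarrow> z k $ s = \<nu> * p ^ k * q ^ (e - k)" by blast
  define upd :: "'a ^ 'n \<Rightarrow> 'a \<Rightarrow> 'a ^ 'n" where "upd x r = (\<chi> i. if i = s then r else x $ i)" for x r
  have "y j = upd h \<mu> * upd a p ^ j * upd b q ^ (l - j)" if "j \<le> l" for j
    unfolding vec_eq_iff using that coord[OF that] pq(1)[OF that] by (auto simp: upd_def vec_power_nth u_def)
  then have "y ` {..l} = (\<lambda>j. upd h \<mu> * upd a p ^ j * upd b q ^ (l - j)) ` {..l}" by (intro image_cong) auto
  then have "D = rs (upd h \<mu>) (upd a p) (upd b q) l" using Dspan by (simp add: rs_def)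
  moreover have "z j = upd h' \<nu> * upd a p ^ j * upd b q ^ (e - j)" if "j \<le> e" for j
    unfolding vec_eq_iff using that coord'[OF that] pq(2)[OF that] by (auto simp: upd_def vec_power_nth v_def)
  then have "z ` {..e} = (\<lambda>j. upd h' \<nu> * upd a p ^ j * upd b q ^ (e - j)) ` {..e}" by (intro image_cong) auto
  then have "E = rs (upd h' \<nu>) (upd a p) (upd b q) e" using Espan by (simp add: rs_def)
  ultimately show ?thesis by blast
qed

section \<open>Three orthogonal codes: the plane case and the induction\<close>

lemma MDS_plane_distinct_points:
  fixes C :: "('a::field ^ 'n::finite) set"
  assumes C: "vec.subspace C" "vec.dim C = 2" and supp: "\<And>x. x \<in> C \<Longrightarrow> vsupp x \<subseteq> I"
    and wt: "\<And>x. x \<in> C \<Longrightarrow> x \<noteq> 0 \<Longrightarrow> card I \<le> hweight x + 1"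
  obtains a b where "a \<in> C" "b \<in> C" "distinct_points I a b"
proof -
  obtain B where B: "B \<subseteq> C" "vec.independent B" "card B = 2"
    using vec.basis_exists[of C] C(2) by metis
  then obtain a b where ab: "B = {a, b}" "a \<noteq> b" by (auto simp: card_2_iff)
  have "distinct_points I a b"
    unfolding distinct_points_def
  proof (intro ballI impI notI)
    fix i j assume ij: "i \<in> I" "j \<in> I" "i \<noteq> j" and eq: "a $ i * b $ j = a $ j * b $ i"
    \<comment> \<open>A non-trivial solution of two equations with vanishing determinant; the
      resulting word has two zeros in \<open>I\<close>, one more than its weight allows.\<close>
    obtain p q where pq: "p \<noteq> 0 \<or> q \<noteq> 0" "p * a $ i + q * b $ i = 0" "p * a $ j + q * b $ j = 0"
    proof (cases "a $ i = 0 \<and> b $ i = 0")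
      case True
      show thesis
      proof (cases "a $ j = 0 \<and> b $ j = 0")
        case True
        then show thesis using \<open>a $ i = 0 \<and> b $ i = 0\<close> that[of 1 0] by simp
      next
        case False
        then show thesis using True that[of "b $ j" "- a $ j"] by auto
      qed
    next
      case False
      then show thesis using eq that[of "b $ i" "- a $ i"] by (auto simp: algebra_simps)
    qed
    let ?x = "p *s a + q *s b"
    have "?x \<in> C" using B ab C(1) by (auto intro!: vec.subspace_add vec.subspace_scale)
    moreover have "?x \<noteq> 0"
    proof
      assume "?x = 0"
      then have "(\<Sum>v\<in>B. (if v = a then p else q) *s v) = 0" using ab by simp
      then have "(if v = a then p else q) = 0" if "v \<in> B" for v
        using vec.independentD[OF B(2) _ subset_refl _ that, of "\<lambda>v. if v = a then p else q"] ab(1) by simp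
      from this[of a] this[of b] show False using ab pq(1) by auto
    qed
    moreover have "vsupp ?x \<subseteq> I - {i, j}" using supp[OF \<open>?x \<in> C\<close>] pq(2,3) by (auto simp: vsupp_def)
    then have "hweight ?x \<le> card (I - {i, j})" by (rule hweight_le_card)
    moreover have "card (I - {i, j}) + 2 = card I"
    proof -
      have "{i, j} \<subseteq> I" using ij by simp
      then have "card (I - {i, j}) + card {i, j} = card I"
        by (metis card_Diff_subset card_mono finite le_add_diff_inverse2)
      then show ?thesis using ij(3) by simp
    qed
    ultimately show False using wt[of ?x] by linarith
  qed
  then show thesis using that B ab by auto
qed

text \<open>A non-zero word vanishing on \<open>dim C - 1\<close> coordinates of \<open>I\<close>
  is, by the weight bound, non-zero at all other coordinates of \<open>I\<close>.\<close>

lemma MDS_obtain_vector: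
  fixes C :: "('a::field ^ 'n::finite) set"
  assumes C: "vec.subspace C" and supp: "\<And>x. x \<in> C \<Longrightarrow> vsupp x \<subseteq> I"
    and wt: "\<And>x. x \<in> C \<Longrightarrow> x \<noteq> 0 \<Longrightarrow> card I + 1 \<le> vec.dim C + hweight x"
    and Q: "Q \<subseteq> I" "Suc (card Q) = vec.dim C" and i: "i \<in> I" "i \<notin> Q"
  obtains c where "c \<in> C" "c $ i \<noteq> 0" "\<forall>j\<in>Q. c $ j = 0"
proof -
  have "card Q < vec.dim C" using Q(2) by simp
  then obtain x where x: "x \<in> C" "x \<noteq> 0" "\<forall>i\<in>Q. x $ i = 0" by (rule obtain_vanishing[OF C])
  have sub: "vsupp x \<subseteq> I - Q" using supp[OF x(1)] x(3) by (auto simp: vsupp_def)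
  have "card (I - Q) = card I - card Q" using Q(1) by (intro card_Diff_subset) auto
  then have "card (I - Q) \<le> card (vsupp x)" using wt[OF x(1,2)] Q(2) by (simp add: hweight_def)
  then have "vsupp x = I - Q" using sub by (intro card_seteq) auto
  then have "x $ i \<noteq> 0" using i by (auto simp: vsupp_def)
  then show thesis using that x(1,3) by blast
qed

text \<open>Products of \<open>a\<close> and \<open>b\<close> with \<open>D\<close> lie in the dual
  of \<open>E\<close> within \<open>I\<close>, whose dimension is at most
  \<open>card I - (e + 1) = l + 2\<close>. This dual is the space \<open>W\<close> of
  \<open>exists_geometric_family\<close>.\<close>

lemma plane_rs:
  fixes D E :: "('a::field ^ 'n::finite) set"
  assumes D: "vec.subspace D" "vec.dim D = Suc l" and E: "vec.subspace E" "vec.dim E = Suc e"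
    and suppD: "\<And>x. x \<in> D \<Longrightarrow> vsupp x \<subseteq> I" and suppE: "\<And>x. x \<in> E \<Longrightarrow> vsupp x \<subseteq> I"
    and wt: "\<And>x. x \<in> D \<Longrightarrow> x \<noteq> 0 \<Longrightarrow> 2 \<le> hweight x"
    and pts: "distinct_points I a b" and I: "card I = l + e + 3"
    and orth: "\<And>x y z. x = a \<or> x = b \<Longrightarrow> y \<in> D \<Longrightarrow> z \<in> E \<Longrightarrow> (\<Sum>i\<in>UNIV. x $ i * y $ i * z $ i) = 0"
  shows "\<exists>h. D = rs h a b l"
proof -
  have I2: "2 \<le> card I" using I by simp
  have "x * y \<in> dual_in I E" if "x = a \<or> x = b" "y \<in> D" for x y
    using orth[OF that] suppD[OF that(2)] by (auto simp: dual_in_def vsupp_def mult_ac)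
  moreover have "vec.dim (dual_in I E) \<le> l + 2" using dim_dual_in_le[OF E(1) suppE] E(2) I by simp
  ultimately obtain h where "h \<noteq> 0" "vsupp h \<subseteq> I" "\<forall>j\<le>l. h * a ^ j * b ^ (l - j) \<in> D"
    using exists_geometric_family[OF pts I2 D suppD wt subspace_dual_in, of I E] by blast
  then show ?thesis using rs_eqI[OF D wt pts I2] by blast
qed

text \<open>Here \<open>C\<close> plays the part of the dual of the product, and \<open>D\<close>
  and \<open>E\<close> are the two codes to parametrise. If \<open>C\<close> is a plane, a basis of
  it gives the points. Otherwise \<open>C\<close> is shortened and \<open>D\<close>,
  \<open>E\<close> are punctured at one coordinate; each puncturing costs at most one unit of
  weight, so weight \<open>k + 2\<close> leaves the weight two that the plane case requires.\<close>

lemma vosper_triple: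
  fixes C D E :: "('a::field ^ 'n::finite) set"
  assumes "0 < l" and "0 < e"
  shows "\<lbrakk>vec.subspace C; vec.subspace D; vec.subspace E;
    \<And>x. x \<in> C \<Longrightarrow> vsupp x \<subseteq> I; supp D = I; supp E = I;
    vec.dim C = k + 2; vec.dim D = Suc l; vec.dim E = Suc e; card I = k + l + e + 3;
    \<And>x. x \<in> C \<Longrightarrow> x \<noteq> 0 \<Longrightarrow> card I \<le> hweight x + k + 1;
    \<And>y. y \<in> D \<Longrightarrow> y \<noteq> 0 \<Longrightarrow> k + 2 \<le> hweight y;
    \<And>z. z \<in> E \<Longrightarrow> z \<noteq> 0 \<Longrightarrow> k + 2 \<le> hweight z;
    \<And>x y z. x \<in> C \<Longrightarrow> y \<in> D \<Longrightarrow> z \<in> E \<Longrightarrow> (\<Sum>i\<in>UNIV. x $ i * y $ i * z $ i) = 0\<rbrakk>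
    \<Longrightarrow> \<exists>a b h h'. D = rs h a b l \<and> E = rs h' a b e"
proof (induction k arbitrary: C D E I)
  case 0
  note C = \<open>vec.subspace C\<close> and D = \<open>vec.subspace D\<close> and E = \<open>vec.subspace E\<close>
  have suppD: "vsupp y \<subseteq> I" if "y \<in> D" for y using that 0(5) by (auto simp: supp_def)
  have suppE: "vsupp y \<subseteq> I" if "y \<in> E" for y using that 0(6) by (auto simp: supp_def)
  have dims: "vec.dim C = 2" "card I = l + e + 3" "card I = e + l + 3"
    "\<And>x. x \<in> C \<Longrightarrow> x \<noteq> 0 \<Longrightarrow> card I \<le> hweight x + 1"
    "\<And>y. y \<in> D \<Longrightarrow> y \<noteq> 0 \<Longrightarrow> 2 \<le> hweight y" "\<And>y. y \<in> E \<Longrightarrow> y \<noteq> 0 \<Longrightarrow> 2 \<le> hweight y"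
    using 0(7,10-13) by (simp_all only: add_0 add_0_right add.commute[of e])
  obtain a b where ab: "a \<in> C" "b \<in> C" and pts: "distinct_points I a b"
    by (rule MDS_plane_distinct_points[OF C dims(1) 0(4) dims(4)])
  have orth: "(\<Sum>i\<in>UNIV. x $ i * y $ i * z $ i) = 0" if "x = a \<or> x = b" "y \<in> D" "z \<in> E" for x y z
    using 0(14) that ab by blast
  have orth': "(\<Sum>i\<in>UNIV. x $ i * z $ i * y $ i) = 0" if "x = a \<or> x = b" "z \<in> E" "y \<in> D" for x y z
    using orth[OF that(1,3,2)] by (simp add: mult.assoc mult.commute[of "y $ _"])
  have "\<exists>h. D = rs h a b l"
    by (rule plane_rs[OF D 0(8) E 0(9) suppD suppE dims(5) pts dims(2) orth])
  moreover have "\<exists>h. E = rs h a b e"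
    by (rule plane_rs[OF E 0(9) D 0(8) suppE suppD dims(6) pts dims(3) orth'])
  ultimately show ?case by blast
next
  case (Suc k)
  note C = \<open>vec.subspace C\<close> and D = \<open>vec.subspace D\<close> and E = \<open>vec.subspace E\<close>
  note suppC = Suc.prems(4) and suppD = Suc.prems(5) and suppE = Suc.prems(6)
  note dimC = Suc.prems(7) and dimD = Suc.prems(8) and dimE = Suc.prems(9) and I = Suc.prems(10)
  note wtC = Suc.prems(11) and wtD = Suc.prems(12) and wtE = Suc.prems(13) and orth = Suc.prems(14)
  have "I \<noteq> {}" using I by auto
  then obtain s where s: "s \<in> I" by auto
  let ?I = "I - {s}"
  have cardI: "card ?I = k + l + e + 3" using I s by simp
  \<comment> \<open>This word is lost in the shortening; it ties the values of \<open>D\<close> and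
    \<open>E\<close> at \<open>s\<close> to their other coordinates.\<close>
  obtain c where c: "c \<in> C" "c $ s \<noteq> 0"
  proof -
    obtain Q where Q: "Q \<subseteq> ?I" "card Q = k + 2"
      using obtain_subset_with_card_n[of "k + 2" ?I] cardI by auto
    have wt: "card I + 1 \<le> vec.dim C + hweight x" if "x \<in> C" "x \<noteq> 0" for x
      using wtC[OF that] dimC by simp
    show thesis
      by (rule MDS_obtain_vector[OF C suppC wt, where Q = Q and i = s]) (use Q s dimC that in auto)
  qed
  define K where "K = {x \<in> C. x $ s = 0}"
  have K: "vec.subspace K"
    using subspace_vanishing[OF C, of "{s}"] by (simp add: K_def)
  have "k + 2 \<le> vec.dim K"
    using dim_le_hyperplane_section[OF C linear_component, of s] dimC by (simp add: K_def)
  then obtain C' where C': "vec.subspace C'" "C' \<subseteq> K" "vec.dim C' = k + 2"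
    by (rule obtain_subspace_of_dim[OF K])
  let ?m = "(*) (ind ?I) :: 'a ^ 'n \<Rightarrow> 'a ^ 'n"
  have inj: "y = 0" if y: "?m y = 0" "vsupp y \<subseteq> I" "y \<noteq> 0 \<Longrightarrow> Suc k + 2 \<le> hweight y" for y
  proof (rule ccontr)
    assume "y \<noteq> 0"
    have "vsupp y \<subseteq> {s}"
    proof
      fix i assume i: "i \<in> vsupp y"
      have "(ind ?I * y) $ i = 0" using y(1) by simp
      then show "i \<in> {s}" using y(2) i by (auto simp: vsupp_def split: if_splits)
    qed
    then show False using hweight_le_card[of y "{s}"] y(3) \<open>y \<noteq> 0\<close> by simp
  qed
  have vsD: "vsupp y \<subseteq> I" if "y \<in> D" for y using that suppD by (auto simp: supp_def)
  have vsE: "vsupp y \<subseteq> I" if "y \<in> E" for y using that suppE by (auto simp: supp_def)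
  have injD: "y = 0" if "y \<in> D" "?m y = 0" for y
    by (rule inj[OF that(2) vsD[OF that(1)] wtD[OF that(1)]])
  have injE: "y = 0" if "y \<in> E" "?m y = 0" for y
    by (rule inj[OF that(2) vsE[OF that(1)] wtE[OF that(1)]])
  have punct: "k + 2 \<le> hweight (?m y)" if "vsupp y \<subseteq> I" "Suc k + 2 \<le> hweight y" for y
  proof -
    have "vsupp y \<subseteq> insert s (vsupp (?m y))" using that(1) by (auto simp: vsupp_def)
    then have "hweight y \<le> card (insert s (vsupp (?m y)))" by (rule hweight_le_card)
    also have "\<dots> \<le> hweight (?m y) + 1" by (simp add: hweight_def card_insert_if)
    finally show ?thesis using that(2) by simp
  qed
  have "\<exists>a b h h'. ?m ` D = rs h a b l \<and> ?m ` E = rs h' a b e"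
  proof (rule Suc.IH[OF C'(1) subspace_times[OF D] subspace_times[OF E], of ?I])
    show "vsupp x \<subseteq> ?I" if "x \<in> C'" for x using that C'(2) suppC by (auto simp: K_def vsupp_def)
    show "supp (?m ` D) = ?I" "supp (?m ` E) = ?I" using suppD suppE by (auto simp: supp_ind_times)
    show "vec.dim C' = k + 2" by (rule C')
    show "vec.dim (?m ` D) = Suc l" using dim_image_inj[OF D linear_times injD] dimD by simp
    show "vec.dim (?m ` E) = Suc e" using dim_image_inj[OF E linear_times injE] dimE by simp
    show "card ?I = k + l + e + 3" by (rule cardI)
    show "card ?I \<le> hweight x + k + 1" if "x \<in> C'" "x \<noteq> 0" for x
      using wtC[of x] that C'(2) s by (auto simp: K_def)
    show "k + 2 \<le> hweight y" if y: "y \<in> ?m ` D" "y \<noteq> 0" for y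
    proof -
      obtain y' where y': "y = ?m y'" "y' \<in> D" using y(1) by auto
      then have "y' \<noteq> 0" using y(2) by auto
      then show ?thesis using punct[OF vsD[OF y'(2)] wtD[OF y'(2)]] y'(1) by simp
    qed
    show "k + 2 \<le> hweight y" if y: "y \<in> ?m ` E" "y \<noteq> 0" for y
    proof -
      obtain y' where y': "y = ?m y'" "y' \<in> E" using y(1) by auto
      then have "y' \<noteq> 0" using y(2) by auto
      then show ?thesis using punct[OF vsE[OF y'(2)] wtE[OF y'(2)]] y'(1) by simp
    qed
    show "(\<Sum>i\<in>UNIV. x $ i * y $ i * z $ i) = 0" if xyz: "x \<in> C'" "y \<in> ?m ` D" "z \<in> ?m ` E" for x y z
    proof -
      obtain y' z' where yz: "y = ?m y'" "y' \<in> D" "z = ?m z'" "z' \<in> E" using xyz by auto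
      have x: "x \<in> C" "x $ s = 0" using xyz(1) C'(2) by (auto simp: K_def)
      have "x $ i * y $ i * z $ i = x $ i * y' $ i * z' $ i" for i
        using x suppC[OF x(1)] yz by (auto simp: vsupp_def)
      then have "(\<Sum>i\<in>UNIV. x $ i * y $ i * z $ i) = (\<Sum>i\<in>UNIV. x $ i * y' $ i * z' $ i)"
        by (intro sum.cong refl)
      then show ?thesis using orth[OF x(1) yz(2,4)] by simp
    qed
  qed
  then obtain a b h h' where ih: "?m ` D = rs h a b l" "?m ` E = rs h' a b e" by blast
  show ?case
    by (rule vosper_step[OF D E s suppD suppE assms orth[OF c(1)] c(2) injD injE ih])
qed

section \<open>From homogeneous coordinates to evaluation points, infinity included\<close>

definition proj_point :: "'a ^ 'n \<Rightarrow> 'a ^ 'n \<Rightarrow> 'n \<Rightarrow> 'a::field option" where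
  "proj_point a b i = (if b $ i = 0 then None else Some (a $ i / b $ i))"

lemma inj_proj_point:
  assumes "distinct_points UNIV a b"
  shows "inj (proj_point a b)"
proof (rule injI, rule ccontr)
  fix i j assume eq: "proj_point a b i = proj_point a b j" and "i \<noteq> j"
  then have "a $ i * b $ j \<noteq> a $ j * b $ i" using assms by (simp add: distinct_points_def)
  with eq show False by (auto simp: proj_point_def field_simps split: if_splits)
qed

text \<open>Homogenisation of \<open>f\<close> in degree \<open>m\<close>. Where \<open>b\<close>
  vanishes only the term \<open>j = m\<close> survives, and \<open>eval_at (Suc m)\<close> reads
  exactly that coefficient at infinity.\<close>

lemma eval_at_proj_point:
  assumes "degree f \<le> m" and "a $ i \<noteq> 0 \<or> b $ i \<noteq> 0"
  shows "(if b $ i = 0 then a $ i ^ m else b $ i ^ m) * eval_at (Suc m) f (proj_point a b i)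
    = (\<Sum>j\<le>m. coeff f j * (a $ i ^ j * b $ i ^ (m - j)))"
proof (cases "b $ i = 0")
  case True
  have "(\<Sum>j\<le>m. coeff f j * (a $ i ^ j * b $ i ^ (m - j))) = (\<Sum>j\<in>{m}. coeff f j * (a $ i ^ j * b $ i ^ (m - j)))"
    using True by (intro sum.mono_neutral_right) auto
  then show ?thesis using True by (simp add: eval_at_def proj_point_def)
next
  case False
  have "poly f (a $ i / b $ i) = (\<Sum>j\<le>m. coeff f j * (a $ i / b $ i) ^ j)"
    unfolding poly_altdef using assms(1)
    by (intro sum.mono_neutral_left) (auto simp: coeff_eq_0)
  then have "b $ i ^ m * poly f (a $ i / b $ i) = (\<Sum>j\<le>m. coeff f j * (b $ i ^ m * (a $ i / b $ i) ^ j))"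
    by (simp add: sum_distrib_left algebra_simps)
  also have "\<dots> = (\<Sum>j\<le>m. coeff f j * (a $ i ^ j * b $ i ^ (m - j)))"
    using False by (intro sum.cong refl) (simp add: power_divide power_diff)
  finally show ?thesis using False by (simp add: eval_at_def proj_point_def)
qed

text \<open>Coefficients are indexed by exponents, so that they can be read as those of a polynomial
  even where generators coincide.\<close>

lemma mem_rs_iff: "x \<in> rs h a b m \<longleftrightarrow> (\<exists>c. x = (\<Sum>j\<le>m. c j *s (h * a ^ j * b ^ (m - j))))"
proof
  assume "x \<in> rs h a b m"
  then show "\<exists>c. x = (\<Sum>j\<le>m. c j *s (h * a ^ j * b ^ (m - j)))"
    unfolding rs_def
  proof (induction rule: vec.span_induct_alt)
    case base
    show ?case by (intro exI[of _ "\<lambda>_. 0"]) simp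
  next
    case (step r x y)
    then obtain k c where "k \<le> m" "x = h * a ^ k * b ^ (m - k)" "y = (\<Sum>j\<le>m. c j *s (h * a ^ j * b ^ (m - j)))"
      by auto
    moreover have "(\<Sum>j\<le>m. (if j = k then r else 0) *s (h * a ^ j * b ^ (m - j))) = r *s (h * a ^ k * b ^ (m - k))"
    proof -
      have "(\<Sum>j\<le>m. (if j = k then r else 0) *s (h * a ^ j * b ^ (m - j)))
        = (\<Sum>j\<le>m. if j = k then r *s (h * a ^ k * b ^ (m - k)) else 0)" by (intro sum.cong) auto
      then show ?thesis using \<open>k \<le> m\<close> by simp
    qed
    ultimately show ?case
      by (intro exI[of _ "\<lambda>j. (if j = k then r else 0) + c j"]) (simp only: vec.scale_left_distrib sum.distrib)
  qed
next
  assume "\<exists>c. x = (\<Sum>j\<le>m. c j *s (h * a ^ j * b ^ (m - j)))"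
  then show "x \<in> rs h a b m"
    unfolding rs_def by (elim exE, simp only:, intro vec.span_sum vec.span_scale vec.span_base) auto
qed

lemma reed_solomon_at_rs:
  fixes a b h :: "'a::field ^ 'n::finite"
  assumes pts: "distinct_points UNIV a b" and n: "2 \<le> CARD('n)" and h: "\<And>i. h $ i \<noteq> 0"
    and dim: "vec.dim (rs h a b m) = Suc m"
  shows "reed_solomon_at (proj_point a b) (rs h a b m)"
proof -
  have nz: "a $ i \<noteq> 0 \<or> b $ i \<noteq> 0" for i using distinct_points_nonzero[OF pts n] by simp
  \<comment> \<open>The multiplier absorbs the factor between homogeneous and affine coordinates,
    which is non-zero because no point is \<open>(0, 0)\<close>.\<close>
  define g where "g = (\<chi> i. h $ i * (if b $ i = 0 then a $ i ^ m else b $ i ^ m))"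
  let ?ev = "\<lambda>f. \<chi> i. g $ i * eval_at (Suc m) f (proj_point a b i)"
  have ev: "?ev f = (\<Sum>j\<le>m. coeff f j *s (h * a ^ j * b ^ (m - j)))" if "degree f \<le> m" for f
    unfolding vec_eq_iff
  proof
    fix i
    have "?ev f $ i = h $ i * ((if b $ i = 0 then a $ i ^ m else b $ i ^ m) * eval_at (Suc m) f (proj_point a b i))"
      by (simp add: g_def)
    also have "\<dots> = (\<Sum>j\<le>m. coeff f j *s (h * a ^ j * b ^ (m - j))) $ i"
      unfolding eval_at_proj_point[where ?a = a and ?b = b, OF that nz]
      by (simp add: sum_distrib_left vec_power_nth algebra_simps)
    finally show "?ev f $ i = (\<Sum>j\<le>m. coeff f j *s (h * a ^ j * b ^ (m - j))) $ i" .
  qed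
  have "rs h a b m = {?ev f |f. f = 0 \<or> degree f < Suc m}"
  proof (intro equalityI subsetI)
    fix x assume "x \<in> rs h a b m"
    then obtain c where c: "x = (\<Sum>j\<le>m. c j *s (h * a ^ j * b ^ (m - j)))" by (auto simp: mem_rs_iff)
    define f where "f = (\<Sum>j\<le>m. monom (c j) j)"
    have "degree f \<le> m" unfolding f_def
      by (intro degree_sum_le) (auto intro: order_trans[OF degree_monom_le])
    moreover have "coeff f j = c j" if "j \<le> m" for j using that by (simp add: f_def coeff_sum)
    ultimately have "x = ?ev f" unfolding c ev[OF \<open>degree f \<le> m\<close>] by (intro sum.cong) auto
    then show "x \<in> {?ev f |f. f = 0 \<or> degree f < Suc m}" using \<open>degree f \<le> m\<close> by auto
  next
    fix x assume "x \<in> {?ev f |f. f = 0 \<or> degree f < Suc m}"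
    then obtain f where "x = ?ev f" "degree f \<le> m" by auto
    then show "x \<in> rs h a b m" using ev mem_rs_iff by blast
  qed
  moreover have "g $ i \<noteq> 0" for i using h[of i] nz[of i] by (auto simp: g_def)
  ultimately show ?thesis
    unfolding reed_solomon_at_def using inj_proj_point[OF pts] dim by (intro conjI exI[of _ "Suc m"] exI[of _ g]) auto
qed

text \<open>If the points at \<open>i\<close> and \<open>j\<close> coincide, all words have
  proportional entries there. A non-zero word vanishing at \<open>i\<close> and at
  \<open>m - 1\<close> further coordinates then vanishes at \<open>j\<close> too, one zero too
  many.\<close>

lemma MDS_rs_distinct_points:
  fixes D :: "('a::field ^ 'n::finite) set"
  assumes rs: "D = rs h a b m" and m: "0 < m" and dim: "vec.dim D = Suc m" and full: "supp D = UNIV"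
    and wt: "\<And>x. x \<in> D \<Longrightarrow> x \<noteq> 0 \<Longrightarrow> CARD('n) \<le> hweight x + m" and n: "m < CARD('n)"
  shows "distinct_points UNIV a b"
  unfolding distinct_points_def
proof (intro ballI impI notI)
  fix i j :: 'n assume "i \<noteq> j" and eq: "a $ i * b $ j = a $ j * b $ i"
  \<comment> \<open>Full support rules out a zero multiplier and also the pair
    \<open>(0, 0)\<close>, where every monomial of degree \<open>m > 0\<close> vanishes.\<close>
  have nz: "h $ i \<noteq> 0 \<and> (a $ i \<noteq> 0 \<or> b $ i \<noteq> 0)" for i
  proof (rule ccontr)
    assume *: "\<not> (h $ i \<noteq> 0 \<and> (a $ i \<noteq> 0 \<or> b $ i \<noteq> 0))"
    have "(h * a ^ j * b ^ (m - j)) $ i = 0" if "j \<le> m" for j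
      using * m that by (cases "j = 0") (auto simp: vec_power_nth)
    moreover have "vec.subspace {x :: 'a ^ 'n. x $ i = 0}" by (auto simp: vec.subspace_def)
    ultimately have "rs h a b m \<subseteq> {x. x $ i = 0}" unfolding rs_def
      by (intro vec.span_minimal) auto
    moreover have "i \<in> supp D" using full by simp
    ultimately show False using rs by (auto simp: mem_supp_iff)
  qed
  obtain r where r: "a $ j = r * a $ i" "b $ j = r * b $ i"
  proof (cases "a $ i = 0")
    case True
    then have "b $ i \<noteq> 0" "a $ j = 0" using nz[of i] eq by auto
    then show thesis using that[of "b $ j / b $ i"] True by simp
  next
    case False
    then show thesis using that[of "a $ j / a $ i"] eq by (simp add: field_simps)
  qed
  define t where "t = h $ j * r ^ m / h $ i"
  have proportional: "x $ j = t * x $ i" if "x \<in> D" for x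
  proof -
    have "vec.subspace {x :: 'a ^ 'n. x $ j = t * x $ i}" by (auto simp: vec.subspace_def algebra_simps)
    moreover have "(h * a ^ k * b ^ (m - k)) $ j = t * (h * a ^ k * b ^ (m - k)) $ i" if "k \<le> m" for k
    proof -
      have "r ^ m = r ^ k * r ^ (m - k)" using that by (simp add: power_add[symmetric])
      then show ?thesis using nz[of i] r by (simp add: vec_power_nth t_def power_mult_distrib)
    qed
    ultimately have "rs h a b m \<subseteq> {x. x $ j = t * x $ i}" unfolding rs_def
      by (intro vec.span_minimal) auto
    then show ?thesis using that rs by auto
  qed
  obtain Q where Q: "i \<in> Q" "j \<notin> Q" "card Q = m"
  proof -
    have "card (UNIV - {i, j}) = CARD('n) - 2"
      using \<open>i \<noteq> j\<close> by (simp add: card_Diff_subset)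
    then have "m - 1 \<le> card (UNIV - {i, j})" using n by linarith
    then obtain Q where Q: "Q \<subseteq> UNIV - {i, j}" "card Q = m - 1"
      by (rule obtain_subset_with_card_n)
    have "i \<notin> Q" "j \<notin> insert i Q" using Q(1) \<open>i \<noteq> j\<close> by auto
    then show thesis using that[of "insert i Q"] Q(2) m by simp
  qed
  have "vec.subspace D" using rs by (simp add: rs_def)
  moreover have "card Q < vec.dim D" using Q dim by simp
  ultimately obtain x where x: "x \<in> D" "x \<noteq> 0" "\<forall>i\<in>Q. x $ i = 0"
    by (rule obtain_vanishing)
  have "x $ j = 0" using proportional[OF x(1)] x(3) Q(1) by simp
  then have "vsupp x \<subseteq> - insert j Q" using x(3) by (auto simp: vsupp_def)
  then have "hweight x \<le> card (- insert j Q)" by (rule hweight_le_card)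
  also have "\<dots> = CARD('n) - Suc m" using Q by (simp add: Compl_eq_Diff_UNIV card_Diff_subset)
  finally show False using wt[OF x(1,2)] n by simp
qed

section \<open>The dual of the product of two MDS codes\<close>

lemma dim_dual_in_ge:
  fixes X :: "('a::field ^ 'n::finite) set"
  shows "CARD('n) \<le> vec.dim (dual_in UNIV X) + vec.dim X"
proof -
  obtain B where B: "B \<subseteq> X" "vec.independent B" "X \<subseteq> vec.span B" "card B = vec.dim X"
    by (rule vec.basis_exists)
  have "{w \<in> UNIV. \<forall>z\<in>B. (\<Sum>i\<in>UNIV. z $ i * w $ i) = 0} \<subseteq> dual_in UNIV X"
  proof
    fix w assume w: "w \<in> {w \<in> UNIV. \<forall>z\<in>B. (\<Sum>i\<in>UNIV. z $ i * w $ i) = 0}"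
    have "vec.subspace {z. (\<Sum>i\<in>UNIV. z $ i * w $ i) = 0}"
      by (auto simp: vec.subspace_def algebra_simps sum.distrib sum_distrib_left[symmetric])
    then have "vec.span B \<subseteq> {z. (\<Sum>i\<in>UNIV. z $ i * w $ i) = 0}"
      using w by (intro vec.span_minimal) auto
    then show "w \<in> dual_in UNIV X" using B(3) by (auto simp: dual_in_def)
  qed
  then have "vec.dim {w \<in> UNIV. \<forall>z\<in>B. (\<Sum>i\<in>UNIV. z $ i * w $ i) = 0} \<le> vec.dim (dual_in UNIV X)"
    by (rule vec.dim_subset)
  moreover have "vec.dim (UNIV :: ('a ^ 'n) set) \<le>
      vec.dim {w \<in> UNIV. \<forall>z\<in>B. (\<Sum>i\<in>UNIV. z $ i * w $ i) = 0} + card B"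
    using vec.finiteI_independent[OF B(2)] by (intro dim_le_linear_eqs linear_dot) simp_all
  ultimately show ?thesis using B(4) by (simp add: card_cart_basis)
qed

text \<open>The support of a lighter \<open>z\<close>, apart from a point \<open>i\<close>, would be
  covered by \<open>dim C - 1\<close> zeros of a word of \<open>C\<close> and
  \<open>dim D - 1\<close> zeros of a word of \<open>D\<close>, both non-zero at \<open>i\<close>.
  Their product would not be orthogonal to \<open>z\<close>.\<close>

lemma MDS_product_dual_hweight:
  fixes C D :: "('a::field ^ 'n::finite) set"
  assumes C: "vec.subspace C" "0 < vec.dim C" and D: "vec.subspace D" "0 < vec.dim D"
    and wtC: "\<And>x. x \<in> C \<Longrightarrow> x \<noteq> 0 \<Longrightarrow> CARD('n) + 1 \<le> vec.dim C + hweight x"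
    and wtD: "\<And>y. y \<in> D \<Longrightarrow> y \<noteq> 0 \<Longrightarrow> CARD('n) + 1 \<le> vec.dim D + hweight y"
    and n: "vec.dim C + vec.dim D \<le> CARD('n)"
    and z: "z \<in> dual_in UNIV (code_prod C D)" "z \<noteq> 0"
  shows "vec.dim C + vec.dim D \<le> hweight z"
proof (rule ccontr)
  assume contr: "\<not> ?thesis"
  obtain i where i: "i \<in> vsupp z" using z(2) by (auto simp: vsupp_def vec_eq_iff)
  have "card (vsupp z - {i}) \<le> vec.dim C + vec.dim D - 2"
    using contr i by (simp add: hweight_def)
  moreover have "vec.dim C + vec.dim D - 2 \<le> card (UNIV - {i})" using n by simp
  ultimately obtain U where U: "vsupp z - {i} \<subseteq> U" "U \<subseteq> UNIV - {i}" "card U = vec.dim C + vec.dim D - 2"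
    using exists_subset_between[of "vsupp z - {i}" _ "UNIV - {i}"] by (metis Diff_mono finite subset_UNIV subset_refl)
  have "vec.dim C - 1 \<le> card U" using U(3) D(2) by simp
  then obtain Q where Q: "Q \<subseteq> U" "card Q = vec.dim C - 1" by (rule obtain_subset_with_card_n)
  have UQ: "card (U - Q) = vec.dim D - 1" using Q U(3) C(2) D(2) by (simp add: card_Diff_subset)
  obtain x where x: "x \<in> C" "x $ i \<noteq> 0" "\<forall>j\<in>Q. x $ j = 0"
    by (rule MDS_obtain_vector[OF C(1) subset_UNIV wtC, where Q = Q and i = i]) (use Q U C(2) in auto)
  obtain y where y: "y \<in> D" "y $ i \<noteq> 0" "\<forall>j\<in>U - Q. y $ j = 0"
    by (rule MDS_obtain_vector[OF D(1) subset_UNIV wtD, where Q = "U - Q" and i = i]) (use UQ U D(2) in auto)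
  have "0 = (\<Sum>j\<in>UNIV. (x * y) $ j * z $ j)"
    using z(1) times_mem_code_prod[OF x(1) y(1)] unfolding dual_in_def mem_Collect_eq by metis
  also have "\<dots> = (\<Sum>j\<in>{i}. (x * y) $ j * z $ j)"
  proof (intro sum.mono_neutral_right ballI)
    fix j assume "j \<in> UNIV - {i}"
    then show "(x * y) $ j * z $ j = 0"
      using x(3) y(3) U(1) by (cases "j \<in> Q"; cases "j \<in> U") (auto simp: vsupp_def)
  qed auto
  finally show False using x(2) y(2) i by (simp add: vsupp_def)
qed

lemma MDS_pair_reed_solomon:
  fixes C D :: "('a::field ^ 'n::finite) set"
  assumes C: "vec.subspace C" "2 \<le> vec.dim C" "supp C = UNIV"
    and D: "vec.subspace D" "2 \<le> vec.dim D" "supp D = UNIV"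
    and wtC: "\<And>x. x \<in> C \<Longrightarrow> x \<noteq> 0 \<Longrightarrow> CARD('n) + 1 \<le> vec.dim C + hweight x"
    and wtD: "\<And>y. y \<in> D \<Longrightarrow> y \<noteq> 0 \<Longrightarrow> CARD('n) + 1 \<le> vec.dim D + hweight y"
    and n: "vec.dim C + vec.dim D + 1 \<le> CARD('n)"
    and prod: "vec.dim (code_prod C D) < vec.dim C + vec.dim D"
  shows "\<exists>\<alpha>. reed_solomon_at \<alpha> C \<and> reed_solomon_at \<alpha> D"
proof -
  \<comment> \<open>Parameters for \<open>vosper_triple\<close>, with the dual of the product in
    first place: the length is \<open>e + k + l + 3\<close>, and as
    \<open>dim (C D) \<le> k + l + 1\<close>, the dual has dimension at least
    \<open>e + 2\<close>.\<close>
  define k l e where "k = vec.dim C - 1" and "l = vec.dim D - 1" and "e = CARD('n) - 1 - vec.dim C - vec.dim D"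
  have kl: "vec.dim C = Suc k" "vec.dim D = Suc l" "0 < k" "0 < l" "CARD('n) = e + k + l + 3"
    using C(2) D(2) n by (auto simp: k_def l_def e_def)
  have "e + 2 \<le> vec.dim (dual_in UNIV (code_prod C D))"
    using dim_dual_in_ge[of "code_prod C D"] prod kl by linarith
  then obtain E where E: "vec.subspace E" "E \<subseteq> dual_in UNIV (code_prod C D)" "vec.dim E = e + 2"
    by (rule obtain_subspace_of_dim[OF subspace_dual_in])
  have wtE: "k + l + 2 \<le> hweight z" if "z \<in> E" "z \<noteq> 0" for z
    using MDS_product_dual_hweight[OF C(1) _ D(1) _ wtC wtD _ _ that(2)] that(1) E(2) n kl by auto
  have "\<exists>a b h h'. C = rs h a b k \<and> D = rs h' a b l"
  proof (rule vosper_triple[OF kl(3,4) E(1) C(1) D(1) subset_UNIV C(3) D(3) E(3) kl(1,2,5)])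
    show "CARD('n) \<le> hweight z + e + 1" if "z \<in> E" "z \<noteq> 0" for z using wtE[OF that] kl by simp
    show "e + 2 \<le> hweight x" if "x \<in> C" "x \<noteq> 0" for x using wtC[OF that] kl by simp
    show "e + 2 \<le> hweight y" if "y \<in> D" "y \<noteq> 0" for y using wtD[OF that] kl by simp
    show "(\<Sum>i\<in>UNIV. z $ i * x $ i * y $ i) = 0" if "z \<in> E" "x \<in> C" "y \<in> D" for x y z
    proof -
      have "(\<Sum>i\<in>UNIV. (x * y) $ i * z $ i) = 0"
        using subsetD[OF E(2) that(1)] times_mem_code_prod[OF that(2,3)]
        unfolding dual_in_def mem_Collect_eq by metis
      then show ?thesis by (simp add: mult_ac)
    qed
  qed
  then obtain a b h h' where rs: "C = rs h a b k" "D = rs h' a b l" by blast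
  have wt: "CARD('n) \<le> hweight x + k" if "x \<in> C" "x \<noteq> 0" for x
    using wtC[OF that] kl(1) by simp
  have "k < CARD('n)" "2 \<le> CARD('n)" using kl by simp_all
  then have pts: "distinct_points UNIV a b"
    by (intro MDS_rs_distinct_points[OF rs(1) kl(3,1) C(3) wt])
  have nz: "h $ i \<noteq> 0" if "supp (rs h a b m) = UNIV" for h i m
    using that vsupp_rs by (fastforce simp: supp_def vsupp_def)
  have "reed_solomon_at (proj_point a b) (rs h a b k)"
    using C(3) kl(1) unfolding rs(1) by (intro reed_solomon_at_rs[OF pts \<open>2 \<le> CARD('n)\<close> nz])
  moreover have "reed_solomon_at (proj_point a b) (rs h' a b l)"
    using D(3) kl(2) unfolding rs(2) by (intro reed_solomon_at_rs[OF pts \<open>2 \<le> CARD('n)\<close> nz])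
  ultimately show ?thesis unfolding rs by blast
qed

section \<open>The two cases of the classification\<close>

theorem theorem2p12:
  fixes C D :: "('a::{finite, field} ^ 'n::finite) set"
  assumes "vec.subspace C" and "vec.subspace D"
    and "supp C = UNIV" and "supp D = UNIV"
    and "product_MDS C D"
  shows
    "(MDS C \<and> MDS D \<and>
      (vec.dim C \<noteq> 1 \<and> vec.dim D \<noteq> 1 \<longrightarrow>
        (\<exists>\<alpha> :: 'n \<Rightarrow> 'a option. reed_solomon_at \<alpha> C \<and> reed_solomon_at \<alpha> D)))
     \<or>
     (\<exists>(h::nat) (I :: nat \<Rightarrow> 'n set)
        (Cs :: nat \<Rightarrow> ('a ^ 'n) set) (Ds :: nat \<Rightarrow> ('a ^ 'n) set).
        (\<forall>i\<in>{1..h}. I i \<noteq> {}) \<and> disjoint_family_on I {1..h} \<and> (\<Union>i\<in>{1..h}. I i) = UNIV \<and>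
        (\<forall>i\<in>{1..h}. vec.subspace (Cs i) \<and> vec.subspace (Ds i) \<and>
           supp (Cs i) = I i \<and> supp (Ds i) = I i) \<and>
        direct_sum {1..h} Cs C \<and> direct_sum {1..h} Ds D \<and>
        (\<forall>i\<in>{1..h}. \<exists>g \<in> I i \<rightarrow>\<^sub>E (UNIV - {0::'a}).
           proj_on (I i) ` Cs i = dual_on (I i) (scale_on (I i) g (proj_on (I i) ` Ds i))))"
proof -
  define d where "d = d_min (code_prod C D)"
  have d: "2 \<le> d" "d + vec.dim C + vec.dim D = CARD('n) + 2"
    using assms(5) by (auto simp: product_MDS_def d_def)
  have wt: "d \<le> hweight w" if "w \<in> code_prod C D" "w \<noteq> 0" for w
    using d_min_le[OF that] by (simp add: d_def)
  show ?thesis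
  proof (cases "d = 2")
    case True
    have "vec.dim C + vec.dim D = CARD('n)" using d(2) True by simp
    moreover have "2 \<le> hweight w" if "w \<in> code_prod C D" "w \<noteq> 0" for w using wt[OF that] True by simp
    ultimately show ?thesis
      by (intro disjI2 complementary_pair_decomposition assms(1-4))
  next
    case False
    then have d3: "3 \<le> d" using d(1) by simp
    have wtp: "d \<le> hweight (x * y)" if "x \<in> C" "y \<in> D" "x * y \<noteq> 0" for x y
      using wt[OF times_mem_code_prod[OF that(1,2)] that(3)] .
    have wtp': "d \<le> hweight (y * x)" if "y \<in> D" "x \<in> C" "y * x \<noteq> 0" for x y
      using wtp[OF that(2,1)] that(3) by (simp add: mult.commute)
    have wtC: "CARD('n) + 1 \<le> vec.dim C + hweight x" if "x \<in> C" "x \<noteq> 0" for x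
      by (rule product_MDS_hweight[OF assms(1-4) d3 wtp d(2) that])
    have d': "d + vec.dim D + vec.dim C = CARD('n) + 2" using d(2) by simp
    have wtD: "CARD('n) + 1 \<le> vec.dim D + hweight y" if "y \<in> D" "y \<noteq> 0" for y
      by (rule product_MDS_hweight[OF assms(2,1,4,3) d3 wtp' d' that])
    \<comment> \<open>Full support excludes dimension zero, so a dimension other than
      \<open>1\<close> is at least \<open>2\<close>.\<close>
    have pos: "0 < vec.dim S" if "supp S = UNIV" for S :: "('a ^ 'n) set"
    proof (rule ccontr)
      assume "\<not> 0 < vec.dim S"
      then have "S \<subseteq> {0}" using vec.dim_eq_0[of S] by simp
      then have "supp S = {}" by (auto simp: supp_def vsupp_def)
      then show False using that by simp
    qed
    have MDS: "MDS C" "MDS D"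
      using MDS_hweightI[OF assms(1) pos[OF assms(3)] wtC] MDS_hweightI[OF assms(2) pos[OF assms(4)] wtD] by auto
    have "\<exists>\<alpha>. reed_solomon_at \<alpha> C \<and> reed_solomon_at \<alpha> D" if "vec.dim C \<noteq> 1" "vec.dim D \<noteq> 1"
    proof (rule MDS_pair_reed_solomon[OF assms(1) _ assms(3) assms(2) _ assms(4) wtC wtD])
      show k: "2 \<le> vec.dim C" and l: "2 \<le> vec.dim D"
        using pos[OF assms(3)] pos[OF assms(4)] that by auto
      show "vec.dim C + vec.dim D + 1 \<le> CARD('n)" using d(2) d3 by simp
      have "vec.dim C + vec.dim D - 1 \<le> CARD('n)" using d(2) d3 by simp
      then obtain P :: "'n set" where P: "card P = vec.dim C + vec.dim D - 1"
        by (rule obtain_subset_with_card_n)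
      \<comment> \<open>The Singleton bound for the product code: a word of it vanishing on
        \<open>P\<close> has weight at most \<open>n - (dim C + dim D - 1) = d - 1\<close> and is
        therefore zero.\<close>
      have "vec.dim (code_prod C D) \<le> card P"
      proof (rule dim_le_card_support[OF subspace_code_prod], rule ccontr)
        fix w assume w: "w \<in> code_prod C D" "\<forall>i\<in>P. w $ i = 0" "w \<noteq> 0"
        have "hweight w \<le> card (- P)" using w(2) by (intro hweight_le_card) (auto simp: vsupp_def)
        also have "\<dots> = CARD('n) - card P" by (simp add: Compl_eq_Diff_UNIV card_Diff_subset)
        finally show False using wt[OF w(1,3)] P d k by linarith
      qed
      then show "vec.dim (code_prod C D) < vec.dim C + vec.dim D" using P k by linarith
    qed
    then show ?thesis using MDS by blast
  qed
qed

end
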